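(* (Soft-thresholding with conservative tuning) Suppose that for given $i\ge1$ satisfying $i\le k=k(n)$ for large enough $n$ we have $\xi_{i,n}\eta_{i,n}\to0$ and $n^{1/2}\eta_{i,n}\to e_i$ where $0\le e_i<\infty$. Set the scaling factor $\alpha_{i,n}=n^{1/2}/\xi_{i,n}$. Suppose that the true parameters $\theta^{(n)}=(\theta_{1,n},\dots,\theta_{k_n,n})\in\mathbb{R}^{k_n}$ (with $k_n=k(n)$) and $\sigma_n\in(0,\infty)$ satisfy $n^{1/2}\theta_{i,n}/(\sigma_n\xi_{i,n})\to\nu_i\in\bar{\mathbb{R}}$. Let $H_n$ denote the cdf of $\sigma_n^{-1}\alpha_{i,n}(\tilde\theta_{S,i}-\theta_{i,n})$ under $P_{n,\theta^{(n)},\sigma_n}$. (a) If $n-k$ is eventually constant equal to $m$, say, then $H_n$ converges weakly to the distribution with cdf $$\int_0^\infty\left\{\Phi(x+se_i)\mathbf{1}(x+\nu_i\ge0)+\Phi(x-se_i)\mathbf{1}(x+\nu_i<0)\right\}\rho_m(s)\,ds,$$ the corresponding measure being $$\int_0^\infty\left\{\Phi(-\nu_i+se_i)-\Phi(-\nu_i-se_i)\right\}\rho_m(s)\,ds\;d\delta_{-\nu_i}(x)+\int_0^\infty\left\{\phi(x+se_i)\mathbf{1}(x+\nu_i>0)+\phi(x-se_i)\mathbf{1}(x+\nu_i<0)\right\}\rho_m(s)\,ds\,dx.$$ (The atomic part is absent in case $|\nu_i|=\infty$. Furthermore, the distribution reduces to a standard normal distribution if $e_i=0$.) (b) If $n-k\to\infty$,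 then $H_n$ converges weakly to the distribution with cdf $$\Phi(x+e_i)\mathbf{1}(x+\nu_i\ge0)+\Phi(x-e_i)\mathbf{1}(x+\nu_i<0),$$ the corresponding measure being $$\left\{\Phi(-\nu_i+e_i)-\Phi(-\nu_i-e_i)\right\}d\delta_{-\nu_i}(x)+\left\{\phi(x+e_i)\mathbf{1}(x+\nu_i>0)+\phi(x-e_i)\mathbf{1}(x+\nu_i<0)\right\}dx$$ (which reduces to a $N(-\mathrm{sign}(\nu_i)e_i,1)$-distribution in case $|\nu_i|=\infty$ or $e_i=0$).
   Context: For each sample size $n$ consider the linear regression model $Y=X\theta+u$, where $X$ is a nonstochastic $n\times k$ matrix of rank $k\ge1$ with $k<n$, $\theta\in\mathbb{R}^k$, $u\sim N(0,\sigma^2I_n)$, $0<\sigma<\infty$. The number $k=k(n)$, the entries of $X,Y,u$ and the underlying probability space may depend on $n$. $P_{n,\theta,\sigma}$ denotes probability under parameters $\theta,\sigma$. $X'$ is the transpose of $X$. $\xi_{i,n}$ is the nonnegative square root of the $i$-th diagonal element of $(X'X/n)^{-1}$. $\hat\theta_{LS}=(X'X)^{-1}X'Y$ with $i$-th component $\hat\theta_{LS,i}$, and $\hat\sigma^2=(n-k)^{-1}(Y-X\hat\theta_{LS})'(Y-X\hat\theta_{LS})$, $\hat\sigma\ge0$. The tuning parameters $\eta_{i,n}$ are positive real numbers. The soft-thresholding estimator is $\tilde\theta_{S,i}=\mathrm{sign}(\hat\theta_{LS,i})(|\hat\theta_{LS,i}|-\hat\sigma\xi_{i,n}\eta_{i,n})_+$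 with $(\cdot)_+=\max(\cdot,0)$. Standing assumption for all asymptotics: $\sup_n\xi_{j,n}^2/n<\infty$ for every fixed $j\ge1$ satisfying $j\le k(n)$ for large enough $n$. $\Phi,\phi$ are the standard normal cdf and pdf, $\Phi(\infty)=1$, $\Phi(-\infty)=0$; $\bar{\mathbb{R}}=\mathbb{R}\cup\{-\infty,\infty\}$; $\delta_z$ is pointmass at $z$; if $|\nu_i|=\infty$ then $x+\nu_i=\nu_i$ and the pointmass term, having zero weight, is absent. $\rho_m$ is the density of $m^{-1/2}$ times the square root of a chi-square random variable with $m$ degrees of freedom, with $\rho_m(s)=0$ for $s<0$. *)

theory Defs
  imports
    "HOL-Probability.Probability"
    "Jordan_Normal_Form.DL_Rank"
    "Jordan_Normal_Form.Gauss_Jordan_Elimination"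
begin

unbundle no vec_syntax
unbundle no inner_syntax

section \<open>The Gaussian linear regression model\<close>

text \<open>
  Under the probability measure \<open>M\<close> the observation satisfies \<open>Y = X \<theta> + u\<close> with
  \<open>u \<sim> N(0, \<sigma>\<^sup>2 I)\<close>, that is, the entries of \<open>u\<close> are independent and each is \<open>N(0, \<sigma>\<^sup>2)\<close>.
  Vectors and matrices are those of Jordan Normal Form, so components are numbered from 0.
\<close>

definition gaussian_linear_model ::
    "'a measure \<Rightarrow> real mat \<Rightarrow> ('a \<Rightarrow> real vec) \<Rightarrow> real vec \<Rightarrow> real \<Rightarrow> bool" where
  "gaussian_linear_model M X Y \<theta> \<sigma> \<longleftrightarrow>
     prob_space M \<and>
     (\<exists>u. (\<forall>\<omega>\<in>space M. u \<omega> \<in> carrier_vec (dim_row X) \<and> Y \<omega> = X *\<^sub>v \<theta> + u \<omega>) \<and>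
          prob_space.indep_vars M (\<lambda>_. borel) (\<lambda>j \<omega>. u \<omega> $ j) {..<dim_row X} \<and>
          (\<forall>j<dim_row X. distributed M lborel (\<lambda>\<omega>. u \<omega> $ j) (normal_density 0 \<sigma>)))"

text \<open>
  \<^const>\<open>mat_inverse\<close> returns an option; the Gram matrices below are invertible whenever \<open>X\<close> has
  full column rank.
\<close>

definition minv :: "real mat \<Rightarrow> real mat" where
  "minv A = the (mat_inverse A)"

definition xi :: "real mat \<Rightarrow> nat \<Rightarrow> real" where
  "xi X i = sqrt (minv ((1 / real (dim_row X)) \<cdot>\<^sub>m (transpose_mat X * X)) $$ (i, i))"

definition theta_LS :: "real mat \<Rightarrow> real vec \<Rightarrow> real vec" where
  "theta_LS X y = (minv (transpose_mat X * X) * transpose_mat X) *\<^sub>v y"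

definition sigma_hat :: "real mat \<Rightarrow> real vec \<Rightarrow> real" where
  "sigma_hat X y =
     sqrt (((y - X *\<^sub>v theta_LS X y) \<bullet> (y - X *\<^sub>v theta_LS X y)) /
           (real (dim_row X) - real (dim_col X)))"

definition theta_soft :: "real mat \<Rightarrow> real \<Rightarrow> real vec \<Rightarrow> nat \<Rightarrow> real" where
  "theta_soft X \<eta> y i =
     sgn (theta_LS X y $ i) * max (\<bar>theta_LS X y $ i\<bar> - sigma_hat X y * xi X i * \<eta>) 0"


section \<open>Distributions\<close>

text \<open>The standard normal cdf, with the values 1 and 0 at plus and minus infinity.\<close>

definition Phi :: "ereal \<Rightarrow> real" where
  "Phi t = (case t of ereal x \<Rightarrow> cdf std_normal_distribution x | PInfty \<Rightarrow> 1 | MInfty \<Rightarrow> 0)"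

abbreviation phi :: "real \<Rightarrow> real" where
  "phi \<equiv> std_normal_density"

text \<open>
  The law of \<open>m\<close> to the power \<open>-1/2\<close> times the square root of a chi-square variable with \<open>m\<close> degrees
  of freedom, the latter being the sum of the squares of \<open>m\<close> independent standard normals.
\<close>

definition scaled_chi_distribution :: "nat \<Rightarrow> real measure" where
  "scaled_chi_distribution m =
     distr (PiM {..<m} (\<lambda>_. std_normal_distribution)) borel
       (\<lambda>z. sqrt (\<Sum>j<m. (z j)\<^sup>2) / sqrt (real m))"

definition rho :: "nat \<Rightarrow> real \<Rightarrow> real" where
  "rho m s = (if s < 0 then 0 else enn2real (RN_deriv lborel (scaled_chi_distribution m) s))"

text \<open>
  The measure \<open>w d\<delta>\<^sub>z(x) + f(x) dx\<close> on the Borel sets of the real line. The atom \<open>z\<close> is an extended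
  real; an infinite \<open>z\<close> is a member of no \<open>ereal ` A\<close>, so that the atomic part is then absent.
\<close>

definition atom_plus_density :: "real \<Rightarrow> ereal \<Rightarrow> (real \<Rightarrow> real) \<Rightarrow> real measure" where
  "atom_plus_density w z f =
     measure_of UNIV (sets borel)
       (\<lambda>A. ennreal w * indicator (ereal ` A) z + (\<integral>\<^sup>+x\<in>A. ennreal (f x) \<partial>lborel))"


section \<open>The limit distributions\<close>

text \<open>
  Addition on \<^typ>\<open>ereal\<close> gives \<open>ereal x + \<nu> = \<nu>\<close> for infinite \<open>\<nu>\<close>, as the formulas require.
\<close>

definition soft_cdf_fixed :: "nat \<Rightarrow> real \<Rightarrow> ereal \<Rightarrow> real \<Rightarrow> real" where
  "soft_cdf_fixed m e \<nu> x =
     (LBINT s:{0..}.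
        (Phi (ereal (x + s * e)) * of_bool (ereal x + \<nu> \<ge> 0) +
         Phi (ereal (x - s * e)) * of_bool (ereal x + \<nu> < 0)) * rho m s)"

definition soft_weight_fixed :: "nat \<Rightarrow> real \<Rightarrow> ereal \<Rightarrow> real" where
  "soft_weight_fixed m e \<nu> =
     (LBINT s:{0..}. (Phi (- \<nu> + ereal (s * e)) - Phi (- \<nu> - ereal (s * e))) * rho m s)"

definition soft_density_fixed :: "nat \<Rightarrow> real \<Rightarrow> ereal \<Rightarrow> real \<Rightarrow> real" where
  "soft_density_fixed m e \<nu> x =
     (LBINT s:{0..}.
        (phi (x + s * e) * of_bool (ereal x + \<nu> > 0) +
         phi (x - s * e) * of_bool (ereal x + \<nu> < 0)) * rho m s)"

definition soft_measure_fixed :: "nat \<Rightarrow> real \<Rightarrow> ereal \<Rightarrow> real measure" where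
  "soft_measure_fixed m e \<nu> =
     atom_plus_density (soft_weight_fixed m e \<nu>) (- \<nu>) (soft_density_fixed m e \<nu>)"

definition soft_cdf :: "real \<Rightarrow> ereal \<Rightarrow> real \<Rightarrow> real" where
  "soft_cdf e \<nu> x =
     Phi (ereal (x + e)) * of_bool (ereal x + \<nu> \<ge> 0) +
     Phi (ereal (x - e)) * of_bool (ereal x + \<nu> < 0)"

definition soft_weight :: "real \<Rightarrow> ereal \<Rightarrow> real" where
  "soft_weight e \<nu> = Phi (- \<nu> + ereal e) - Phi (- \<nu> - ereal e)"

definition soft_density :: "real \<Rightarrow> ereal \<Rightarrow> real \<Rightarrow> real" where
  "soft_density e \<nu> x =
     phi (x + e) * of_bool (ereal x + \<nu> > 0) + phi (x - e) * of_bool (ereal x + \<nu> < 0)"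

definition soft_measure :: "real \<Rightarrow> ereal \<Rightarrow> real measure" where
  "soft_measure e \<nu> = atom_plus_density (soft_weight e \<nu>) (- \<nu>) (soft_density e \<nu>)"


section \<open>The definitions by \<^const>\<open>measure_of\<close> and \<^const>\<open>RN_deriv\<close> are the intended objects\<close>

lemma space_atom_plus_density [simp]: "space (atom_plus_density w z f) = UNIV"
  and sets_atom_plus_density [simp]: "sets (atom_plus_density w z f) = sets borel"
  using sets.sigma_sets_eq[of borel]
  by (simp_all add: atom_plus_density_def space_measure_of_conv)

lemma emeasure_atom_plus_density:
  assumes "f \<in> borel_measurable borel" and "A \<in> sets borel"
  shows "emeasure (atom_plus_density w z f) A =
    ennreal w * indicator (ereal ` A) z + (\<integral>\<^sup>+x\<in>A. ennreal (f x) \<partial>lborel)"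
  unfolding atom_plus_density_def
proof (rule emeasure_measure_of_sigma)
  let ?\<mu> = "\<lambda>A. ennreal w * indicator (ereal ` A) z + (\<integral>\<^sup>+x\<in>A. ennreal (f x) \<partial>lborel)"
  show "sigma_algebra UNIV (sets (borel :: real measure))"
    using sets.sigma_algebra_axioms[of borel] by simp
  show "positive (sets borel) ?\<mu>"
    by (simp add: positive_def)
  show "countably_additive (sets borel) ?\<mu>"
  proof (rule countably_additiveI)
    fix B :: "nat \<Rightarrow> real set"
    assume B: "range B \<subseteq> sets borel" "disjoint_family B"
    have m: "f \<in> borel_measurable lborel"
      using assms(1) by simp
    have "(\<Sum>n. indicator (ereal ` B n) z :: ennreal) = indicator (\<Union>n. ereal ` B n) z"
    proof (rule suminf_indicator)
      show "disjoint_family (\<lambda>n. ereal ` B n)"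
        using B(2) by (auto simp: disjoint_family_on_def)
    qed
    then have 1: "(\<Sum>n. ennreal w * indicator (ereal ` B n) z) =
        ennreal w * indicator (ereal ` (\<Union>n. B n)) z"
      by (simp only: image_UN ennreal_suminf_cmult)
    have "(\<Sum>n. emeasure (density lborel (\<lambda>x. ennreal (f x))) (B n)) =
        emeasure (density lborel (\<lambda>x. ennreal (f x))) (\<Union>n. B n)"
      by (rule suminf_emeasure) (use B in auto)
    then have 2: "(\<Sum>n. \<integral>\<^sup>+x\<in>B n. ennreal (f x) \<partial>lborel) = (\<integral>\<^sup>+x\<in>(\<Union>n. B n). ennreal (f x) \<partial>lborel)"
      using m B by (subst (asm) (1 2) emeasure_density) auto
    show "(\<Sum>n. ?\<mu> (B n)) = ?\<mu> (\<Union>n. B n)"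
      unfolding 1[symmetric] 2[symmetric] by (rule suminf_add[symmetric]) auto
  qed
qed (use assms in simp)

lemma prob_space_scaled_chi: "prob_space (scaled_chi_distribution m)"
proof -
  interpret product_prob_space "\<lambda>_::nat. std_normal_distribution" "{..<m}"
    by (intro product_prob_spaceI real_distribution.axioms(1) real_dist_normal_dist)
  show ?thesis
    unfolding scaled_chi_distribution_def by (rule prob_space_distr) measurable
qed

lemma null_preimage_chi:
  fixes c S :: real
  assumes N: "N \<in> null_sets lborel" and c: "c > 0" and S: "S \<ge> 0"
  shows "AE y in lborel. sqrt (S + y\<^sup>2) / c \<notin> N"
proof -
  let ?T = "{t \<in> N. (c * t)\<^sup>2 - S > 0}"
  have "negligible N"
    using N by (simp add: negligible_iff_null_sets null_sets_completionI)
  then have T: "negligible ?T"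
    by (rule negligible_subset) auto
  have neg: "negligible ((\<lambda>t. a * sqrt ((c * t)\<^sup>2 - S)) ` ?T)" for a :: real
  proof (rule negligible_differentiable_image_negligible[OF _ T])
    show "(\<lambda>t. a * sqrt ((c * t)\<^sup>2 - S)) differentiable_on ?T"
      unfolding differentiable_on_def
    proof
      fix t assume t: "t \<in> ?T"
      have "\<exists>D. ((\<lambda>t. a * sqrt ((c * t)\<^sup>2 - S)) has_real_derivative D) (at t)"
        using t by (intro exI) (rule derivative_eq_intros refl | simp)+
      then show "(\<lambda>t. a * sqrt ((c * t)\<^sup>2 - S)) differentiable (at t within ?T)"
        using differentiable_at_withinI real_differentiable_def by blast
    qed
  qed simp
  let ?E = "insert 0 ((\<lambda>t. 1 * sqrt ((c * t)\<^sup>2 - S)) ` ?T \<union> (\<lambda>t. (-1) * sqrt ((c * t)\<^sup>2 - S)) ` ?T)"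
  have "negligible ?E"
    using neg[of 1] neg[of "-1"] by (intro negligible_insert[THEN iffD2] negligible_Un) auto
  then have E: "?E \<in> null_sets (completion lborel)"
    by (simp add: negligible_iff_null_sets)
  have "y \<in> ?E" if "sqrt (S + y\<^sup>2) / c \<in> N" for y
  proof (cases "y = 0")
    case False
    let ?t = "sqrt (S + y\<^sup>2) / c"
    have eq: "(c * ?t)\<^sup>2 - S = y\<^sup>2"
      using c S by simp
    then have tT: "?t \<in> ?T"
      using that False unfolding mem_Collect_eq eq by simp
    show ?thesis
    proof (cases "y > 0")
      case True
      then have "y = 1 * sqrt ((c * ?t)\<^sup>2 - S)"
        unfolding eq by simp
      then show ?thesis using tT by blast
    next
      case f: False
      then have "y = (-1) * sqrt ((c * ?t)\<^sup>2 - S)"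
        unfolding eq by simp
      then show ?thesis using tT by blast
    qed
  qed simp
  then have "AE y in completion lborel. sqrt (S + y\<^sup>2) / c \<notin> N"
    by (intro AE_I'[OF E]) blast
  then show ?thesis
    by (simp add: AE_completion_iff)
qed

lemma absolutely_continuous_scaled_chi:
  assumes "m > 0"
  shows "absolutely_continuous lborel (scaled_chi_distribution m)"
  unfolding absolutely_continuous_def
proof
  fix N :: "real set"
  assume N: "N \<in> null_sets lborel"
  then have Nb [measurable]: "N \<in> sets borel"
    by auto
  obtain k where k: "m = Suc k"
    using assms by (cases m) auto
  interpret product_prob_space "\<lambda>_::nat. std_normal_distribution" "{..<m}"
    by (intro product_prob_spaceI real_distribution.axioms(1) real_dist_normal_dist)
  let ?P = "\<lambda>I::nat set. PiM I (\<lambda>_. std_normal_distribution)"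
  let ?h = "\<lambda>z::nat \<Rightarrow> real. sqrt (\<Sum>j<m. (z j)\<^sup>2) / sqrt (real m)"
  have h [measurable]: "?h \<in> borel_measurable (?P {..<m})"
    by measurable
  have meas: "(\<lambda>z. indicator N (?h z) :: ennreal) \<in> borel_measurable (?P (insert k {..<k}))"
    unfolding lessThan_Suc[symmetric] k[symmetric] by measurable
  have "emeasure (scaled_chi_distribution m) N = (\<integral>\<^sup>+z. indicator N (?h z) \<partial>?P {..<m})"
    unfolding scaled_chi_distribution_def
    by (subst nn_integral_indicator[symmetric], simp, subst nn_integral_distr) auto
  also have "\<dots> = (\<integral>\<^sup>+z. (\<integral>\<^sup>+y. indicator N (?h (z(k := y))) \<partial>std_normal_distribution) \<partial>?P {..<k})"
    using product_nn_integral_insert[OF _ _ meas] by (simp add: k lessThan_Suc)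
  also have "\<dots> = (\<integral>\<^sup>+z. 0 \<partial>?P {..<k})"
  proof (rule nn_integral_cong)
    fix z :: "nat \<Rightarrow> real"
    have eq: "?h (z(k := y)) = sqrt ((\<Sum>j<k. (z j)\<^sup>2) + y\<^sup>2) / sqrt (real m)" for y
      by (simp add: k)
    have "AE y in lborel. ?h (z(k := y)) \<notin> N"
      unfolding eq using assms by (intro null_preimage_chi N sum_nonneg) auto
    then have "AE y in std_normal_distribution. ?h (z(k := y)) \<notin> N"
      by (subst AE_density) auto
    then have "AE y in std_normal_distribution. (indicator N (?h (z(k := y))) :: ennreal) = 0"
      by eventually_elim simp
    then show "(\<integral>\<^sup>+y. indicator N (?h (z(k := y))) \<partial>std_normal_distribution) = (0 :: ennreal)"
      by (subst nn_integral_cong_AE[where v = "\<lambda>_. 0"]) auto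
  qed
  finally show "N \<in> null_sets (scaled_chi_distribution m)"
    by (simp add: null_setsI scaled_chi_distribution_def)
qed

lemma density_rho:
  assumes "m > 0"
  shows "density lborel (\<lambda>s. ennreal (rho m s)) = scaled_chi_distribution m"
proof -
  let ?L = "scaled_chi_distribution m"
  interpret L: prob_space ?L
    by (rule prob_space_scaled_chi)
  have sets: "sets ?L = sets lborel"
    by (simp add: scaled_chi_distribution_def)
  have dens: "density lborel (RN_deriv lborel ?L) = ?L"
    by (rule sigma_finite_measure.density_RN_deriv[OF sigma_finite_lborel absolutely_continuous_scaled_chi[OF assms] sets])
  have fin: "AE s in lborel. RN_deriv lborel ?L s \<noteq> \<infinity>"
    by (rule sigma_finite_measure.RN_deriv_finite[OF sigma_finite_lborel
          L.sigma_finite_measure absolutely_continuous_scaled_chi[OF assms] sets])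
  have "emeasure ?L {..<0} = 0"
  proof -
    have "0 \<le> sqrt (\<Sum>j<m. (z j)\<^sup>2) / sqrt (real m)" for z :: "nat \<Rightarrow> real"
      by (intro divide_nonneg_nonneg real_sqrt_ge_zero sum_nonneg) auto
    then have "(\<lambda>z::nat \<Rightarrow> real. sqrt (\<Sum>j<m. (z j)\<^sup>2) / sqrt (real m)) -` {..<0} = {}"
      by (auto simp: not_less[symmetric])
    then show ?thesis
      unfolding scaled_chi_distribution_def by (subst emeasure_distr) simp_all
  qed
  then have "emeasure (density lborel (RN_deriv lborel ?L)) {..<0} = 0"
    by (simp add: dens)
  then have neg: "AE s in lborel. s < 0 \<longrightarrow> RN_deriv lborel ?L s = 0"
    by (simp add: emeasure_density nn_integral_0_iff_AE indicator_eq_0_iff)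
       (auto elim!: eventually_mono)
  have "density lborel (\<lambda>s. ennreal (rho m s)) = density lborel (RN_deriv lborel ?L)"
  proof (rule density_cong)
    show "(\<lambda>s. ennreal (rho m s)) \<in> borel_measurable lborel"
      unfolding rho_def by measurable
    show "AE s in lborel. ennreal (rho m s) = RN_deriv lborel ?L s"
      using fin neg by eventually_elim (auto simp: rho_def less_top)
  qed simp
  then show ?thesis
    by (simp add: dens)
qed

end

theory Submission
  imports Defs
begin

text \<open>
  Write \<open>Z\<close> for the standardised error of the \<open>i\<close>-th least squares component and \<open>S\<close> for
  \<open>sigma_hat / \<sigma>\<close>. Measured on the scale \<open>\<sigma> \<xi> / sqrt n\<close>, the estimator is the soft threshold of
  \<open>Z + \<nu>\<^sub>n\<close> at level \<open>S a\<^sub>n\<close>, where \<open>\<nu>\<^sub>n = sqrt n \<theta>\<^sub>i / (\<sigma> \<xi>)\<close> and \<open>a\<^sub>n = sqrt n \<eta>\<close>. Soft thresholding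
  is monotone, and inverting it turns the event that the centred estimator is at most \<open>x\<close> into
  \<open>Z \<le> x + S a\<^sub>n\<close> if \<open>x + \<nu>\<^sub>n \<ge> 0\<close> and \<open>Z \<le> x - S a\<^sub>n\<close> otherwise. The two variables are
  independent, \<open>Z\<close> being standard normal and \<open>S\<close> scaled chi with \<open>n - k\<close> degrees of freedom, so the
  finite-sample cdf is exactly the mixture \<open>E (soft_cdf (S a\<^sub>n) \<nu>\<^sub>n x)\<close>: it has the shape of the limit
  in case (a), with \<open>a\<^sub>n\<close>, \<open>\<nu>\<^sub>n\<close> in place of \<open>e\<close>, \<open>\<nu>\<close> (\<open>theta_soft_cdf\<close>).

  The joint law of \<open>Z\<close> and \<open>S\<close> rests on rotation invariance of the standard Gaussian measure on
  \<open>R\<^sup>n\<close>. For planar rotations this is a change of variables; a composition of Givens rotations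
  carries the column space of \<open>X\<close> onto the first \<open>k\<close> coordinates
  (\<open>gauss_isometry_into_first_coordinates\<close>). In the rotated coordinates \<open>Z\<close> is a unit combination of
  the first \<open>k\<close> entries, and the residual vector consists of the remaining \<open>n - k\<close> entries
  (\<open>least_squares_rotated\<close>, \<open>gaussian_linear_model_joint_law\<close>).

  For the limit, fix \<open>x \<noteq> - \<nu>\<close>. The sign of \<open>x + \<nu>\<^sub>n\<close> is then eventually that of \<open>x + \<nu>\<close>, and since
  \<open>\<Phi>\<close> is 1-Lipschitz, the distance to the limit cdf is at most \<open>|a\<^sub>n - e| E S\<close> when the degrees of
  freedom stay constant, and at most \<open>a\<^sub>n E |S - 1| + |a\<^sub>n - e|\<close> when they grow; here
  \<open>E |S - 1| \<le> E |S\<^sup>2 - 1| \<le> sqrt (2 / (n - k))\<close> because \<open>S\<^sup>2\<close> is a mean of \<open>n - k\<close> squares of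
  independent normals. The single remaining point \<open>- \<nu>\<close> matters only if the limit is continuous there, and then
  monotonicity of the cdfs settles it (\<open>weak_conv_off_one_point\<close>).

  That the limit formulas are the cdfs of the stated measures is an integration of the two shifted
  normal densities on either side of the atom (\<open>emeasure_soft_measure_atMost\<close>); case (a) follows from
  case (b) by mixing over the scale.
\<close>

section \<open>Rotation invariance of the standard Gaussian measure\<close>

text \<open>
  One-dimensional affine substitutions suffice: as \<open>c \<noteq> 0\<close>, the rotation factors into
  \<open>x \<mapsto> c x + s y = u\<close> for fixed \<open>y\<close>, followed by \<open>y \<mapsto> (y - s u) / c\<close> for fixed \<open>u\<close>. The Jacobians
  are \<open>c\<close> and \<open>1 / c\<close> and cancel.
\<close>

lemma lborel_planar_rotation:
  fixes f :: "real \<times> real \<Rightarrow> ennreal" and c s :: real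
  assumes [measurable]: "f \<in> borel_measurable (borel \<Otimes>\<^sub>M borel)"
    and cs: "c\<^sup>2 + s\<^sup>2 = 1" and c: "c \<noteq> 0"
  shows "(\<integral>\<^sup>+x. \<integral>\<^sup>+y. f (c * x + s * y, c * y - s * x) \<partial>lborel \<partial>lborel) =
    (\<integral>\<^sup>+x. \<integral>\<^sup>+y. f (x, y) \<partial>lborel \<partial>lborel)"
proof -
  let ?I = "\<integral>\<^sup>+x. \<integral>\<^sup>+y. f (c * x + s * y, c * y - s * x) \<partial>lborel \<partial>lborel"
  have slice: "\<bar>c\<bar> * (\<integral>\<^sup>+x. f (c * x + s * y, c * y - s * x) \<partial>lborel) =
      (\<integral>\<^sup>+u. f (u, (y - s * u) / c) \<partial>lborel)" for y
  proof -
    have "(y - s * (s * y + c * x)) / c = c * y - s * x" for x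
    proof -
      have "(y - s * (s * y + c * x)) = y * (1 - s\<^sup>2) - c * s * x"
        by (simp add: algebra_simps power2_eq_square)
      also have "1 - s\<^sup>2 = c * c"
        using cs by (simp add: power2_eq_square)
      finally show ?thesis
        using c by (simp add: field_simps)
    qed
    then show ?thesis
      using nn_integral_real_affine[of "\<lambda>u. f (u, (y - s * u) / c)" c "s * y"] c
      by (simp add: add.commute)
  qed
  have "\<bar>c\<bar> * ?I = \<bar>c\<bar> * (\<integral>\<^sup>+y. \<integral>\<^sup>+x. f (c * x + s * y, c * y - s * x) \<partial>lborel \<partial>lborel)"
    by (subst lborel_pair.Fubini') (auto)
  also have "\<dots> = (\<integral>\<^sup>+y. \<integral>\<^sup>+u. f (u, (y - s * u) / c) \<partial>lborel \<partial>lborel)"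
    by (subst nn_integral_cmult[symmetric]) (auto simp: slice)
  also have "\<dots> = (\<integral>\<^sup>+u. \<integral>\<^sup>+y. f (u, (y - s * u) / c) \<partial>lborel \<partial>lborel)"
    by (subst lborel_pair.Fubini') (auto)
  also have "\<dots> = (\<integral>\<^sup>+u. \<bar>c\<bar> * (\<integral>\<^sup>+y. f (u, y) \<partial>lborel) \<partial>lborel)"
  proof (rule nn_integral_cong)
    fix u :: real
    show "(\<integral>\<^sup>+y. f (u, (y - s * u) / c) \<partial>lborel) = \<bar>c\<bar> * (\<integral>\<^sup>+y. f (u, y) \<partial>lborel)"
      using nn_integral_real_affine[of "\<lambda>y. f (u, (y - s * u) / c)" c "s * u"] c by simp
  qed
  also have "\<dots> = \<bar>c\<bar> * (\<integral>\<^sup>+x. \<integral>\<^sup>+y. f (x, y) \<partial>lborel \<partial>lborel)"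
    by (subst nn_integral_cmult) auto
  finally show ?thesis
    using c by (auto simp: ennreal_mult_cancel_left)
qed

lemma std_normal_planar_rotation_generic:
  fixes f :: "real \<times> real \<Rightarrow> ennreal" and c s :: real
  assumes f [measurable]: "f \<in> borel_measurable (borel \<Otimes>\<^sub>M borel)"
    and cs: "c\<^sup>2 + s\<^sup>2 = 1" and c: "c \<noteq> 0"
  shows "(\<integral>\<^sup>+x. \<integral>\<^sup>+y. f (c * x + s * y, c * y - s * x) \<partial>std_normal_distribution \<partial>std_normal_distribution) =
    (\<integral>\<^sup>+x. \<integral>\<^sup>+y. f (x, y) \<partial>std_normal_distribution \<partial>std_normal_distribution)"
proof -
  have dens: "(\<integral>\<^sup>+x. \<integral>\<^sup>+y. h (x, y) \<partial>std_normal_distribution \<partial>std_normal_distribution) =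
      (\<integral>\<^sup>+x. \<integral>\<^sup>+y. ennreal (phi x * phi y) * h (x, y) \<partial>lborel \<partial>lborel)"
    if [measurable]: "h \<in> borel_measurable (borel \<Otimes>\<^sub>M borel)" for h :: "real \<times> real \<Rightarrow> ennreal"
    by (subst nn_integral_density; (simp add: nn_integral_density)?)
       (simp add: nn_integral_cmult[symmetric] ennreal_mult mult.assoc)
  let ?g = "\<lambda>p. ennreal (phi (fst p) * phi (snd p)) * f p"
  have inv: "phi (c * x + s * y) * phi (c * y - s * x) = phi x * phi y" for x y
  proof -
    have "(c * x + s * y)\<^sup>2 + (c * y - s * x)\<^sup>2 = (c\<^sup>2 + s\<^sup>2) * (x\<^sup>2 + y\<^sup>2)"
      by (simp add: power2_eq_square algebra_simps)
    then have "- ((c * x + s * y)\<^sup>2 / 2) + - ((c * y - s * x)\<^sup>2 / 2) = - (x\<^sup>2 / 2) + - (y\<^sup>2 / 2)"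
      using cs by (simp add: field_simps)
    then show ?thesis
      by (simp add: std_normal_density_def exp_add[symmetric] field_simps)
  qed
  have "(\<integral>\<^sup>+x. \<integral>\<^sup>+y. f (c * x + s * y, c * y - s * x) \<partial>std_normal_distribution \<partial>std_normal_distribution) =
      (\<integral>\<^sup>+x. \<integral>\<^sup>+y. ?g (c * x + s * y, c * y - s * x) \<partial>lborel \<partial>lborel)"
    using dens[of "\<lambda>(x, y). f (c * x + s * y, c * y - s * x)"] by (simp add: inv)
  also have "\<dots> = (\<integral>\<^sup>+x. \<integral>\<^sup>+y. ?g (x, y) \<partial>lborel \<partial>lborel)"
    by (rule lborel_planar_rotation) (use cs c in measurable)
  also have "\<dots> = (\<integral>\<^sup>+x. \<integral>\<^sup>+y. f (x, y) \<partial>std_normal_distribution \<partial>std_normal_distribution)"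
    using dens[of f] by simp
  finally show ?thesis .
qed

text \<open>
  The remaining case \<open>c = 0\<close> is a quarter turn, hence the square of a rotation by 45 degrees.
\<close>

lemma std_normal_planar_rotation:
  fixes f :: "real \<times> real \<Rightarrow> ennreal" and c s :: real
  assumes f [measurable]: "f \<in> borel_measurable (borel \<Otimes>\<^sub>M borel)"
    and cs: "c\<^sup>2 + s\<^sup>2 = 1"
  shows "(\<integral>\<^sup>+x. \<integral>\<^sup>+y. f (c * x + s * y, c * y - s * x) \<partial>std_normal_distribution \<partial>std_normal_distribution) =
    (\<integral>\<^sup>+x. \<integral>\<^sup>+y. f (x, y) \<partial>std_normal_distribution \<partial>std_normal_distribution)"
proof (cases "c = 0")
  case False
  with f cs show ?thesis by (rule std_normal_planar_rotation_generic)
next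
  case True
  \<comment> \<open>The coefficients of the rotation by \<open>s\<close> times 45 degrees are \<open>d\<close> and \<open>s d\<close>.\<close>
  define d where "d = 1 / sqrt 2"
  have d: "d\<^sup>2 + (s * d)\<^sup>2 = 1" "d \<noteq> 0" and dd: "d * d = 1 / 2" and ss: "s * s = 1"
    using cs True by (simp_all add: d_def power_mult_distrib power2_eq_square)
  let ?h = "\<lambda>p. f (d * fst p + s * d * snd p, d * snd p - s * d * fst p)"
  have "?h (d * x + s * d * y, d * y - s * d * x) = f (s * y, - (s * x))" for x y
  proof -
    have "d * (d * x + s * d * y) + s * d * (d * y - s * d * x) =
        (d * d) * ((1 - s * s) * x + 2 * s * y)"
      and "d * (d * y - s * d * x) - s * d * (d * x + s * d * y) =
        (d * d) * ((1 - s * s) * y - 2 * s * x)"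
      by (simp_all add: algebra_simps)
    then show ?thesis by (simp add: dd ss)
  qed
  then show ?thesis
    using std_normal_planar_rotation_generic[of ?h d "s * d"] std_normal_planar_rotation_generic[OF f d] d True
    by simp
qed

abbreviation std_gaussian :: "nat \<Rightarrow> (nat \<Rightarrow> real) measure" where
  "std_gaussian n \<equiv> PiM {..<n} (\<lambda>_. std_normal_distribution)"

lemma prob_space_std_normal: "prob_space std_normal_distribution"
  by (rule prob_space_normal_density) simp

lemma prob_space_std_gaussian: "prob_space (PiM I (\<lambda>_. std_normal_distribution))"
  by (intro prob_space_PiM prob_space_std_normal)

definition givens :: "nat \<Rightarrow> nat \<Rightarrow> real \<Rightarrow> real \<Rightarrow> (nat \<Rightarrow> real) \<Rightarrow> nat \<Rightarrow> real" where
  "givens p q c s z = z(p := c * z p + s * z q, q := c * z q - s * z p)"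

text \<open>
  Orthogonal transformations of \<open>R\<^sup>n\<close> that preserve the standard Gaussian measure. They act on all
  functions \<open>nat \<Rightarrow> real\<close>, so that linearity needs no carrier; only the coordinates below \<open>n\<close> enter the
  scalar product and the measure. Invariance of the measure is part of the definition because it is
  established for Givens rotations only and then inherited by compositions.
\<close>

definition gauss_isometry :: "nat \<Rightarrow> ((nat \<Rightarrow> real) \<Rightarrow> nat \<Rightarrow> real) \<Rightarrow> bool" where
  "gauss_isometry n G \<longleftrightarrow>
     (\<forall>a b x y. G (\<lambda>l. a * x l + b * y l) = (\<lambda>l. a * G x l + b * G y l)) \<and>
     (\<forall>x y. (\<Sum>l<n. G x l * G y l) = (\<Sum>l<n. x l * y l)) \<and>
     G \<in> measurable (std_gaussian n) (std_gaussian n) \<and>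
     distr (std_gaussian n) (std_gaussian n) G = std_gaussian n"

lemma gauss_isometry_id: "gauss_isometry n (\<lambda>x. x)"
  by (simp add: gauss_isometry_def)

lemma gauss_isometry_comp:
  assumes F: "gauss_isometry n F" and G: "gauss_isometry n G"
  shows "gauss_isometry n (\<lambda>x. F (G x))"
proof -
  have m: "F \<in> measurable (std_gaussian n) (std_gaussian n)" "G \<in> measurable (std_gaussian n) (std_gaussian n)"
    using F G by (simp_all add: gauss_isometry_def)
  have "distr (std_gaussian n) (std_gaussian n) (\<lambda>x. F (G x)) =
      distr (distr (std_gaussian n) (std_gaussian n) G) (std_gaussian n) F"
    using distr_distr[OF m] by (simp add: comp_def)
  also have "\<dots> = std_gaussian n"
    using F G by (simp add: gauss_isometry_def)
  finally show ?thesis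
    using F G measurable_compose[OF m(2,1)] unfolding gauss_isometry_def by simp
qed

lemma measurable_givens:
  assumes "p < n" "q < n"
  shows "givens p q c s \<in> measurable (std_gaussian n) (std_gaussian n)"
proof (rule measurable_PiM_single')
  fix l assume l: "l \<in> {..<n}"
  show "(\<lambda>z. givens p q c s z l) \<in> measurable (std_gaussian n) std_normal_distribution"
    using assms l unfolding givens_def fun_upd_def by (cases "l = q"; cases "l = p") simp_all
qed (use assms in \<open>auto simp: givens_def space_PiM PiE_iff extensional_def\<close>)

text \<open>
  Integrating out the coordinates \<open>p\<close> and \<open>q\<close> first reduces the claim to a planar rotation.
\<close>

lemma std_gaussian_givens:
  assumes pq: "p < n" "q < n" "p \<noteq> q" and cs: "c\<^sup>2 + s\<^sup>2 = 1"
  shows "distr (std_gaussian n) (std_gaussian n) (givens p q c s) = std_gaussian n"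
proof (rule measure_eqI)
  interpret product_sigma_finite "\<lambda>_::nat. std_normal_distribution"
    by (intro product_sigma_finite.intro prob_space_imp_sigma_finite prob_space_std_normal)
  fix A assume "A \<in> sets (distr (std_gaussian n) (std_gaussian n) (givens p q c s))"
  then have A [measurable]: "A \<in> sets (std_gaussian n)"
    by simp
  note measurable_givens[OF pq(1,2), measurable]
  define I where "I = {..<n} - {p, q}"
  have I: "finite I" "q \<notin> I" "p \<notin> insert q I" "{..<n} = insert p (insert q I)"
    using pq by (auto simp: I_def)
  have iter: "(\<integral>\<^sup>+z. f z \<partial>std_gaussian n) =
      (\<integral>\<^sup>+z. \<integral>\<^sup>+y. \<integral>\<^sup>+x. f (z(q := y, p := x)) \<partial>std_normal_distribution \<partial>std_normal_distribution
        \<partial>PiM I (\<lambda>_. std_normal_distribution))"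
    if f [measurable]: "f \<in> borel_measurable (std_gaussian n)" for f :: "_ \<Rightarrow> ennreal"
  proof -
    have f' [measurable]: "f \<in> borel_measurable (PiM (insert p (insert q I)) (\<lambda>_. std_normal_distribution))"
      using f unfolding I(4) .
    have "(\<integral>\<^sup>+z. f z \<partial>std_gaussian n) =
        (\<integral>\<^sup>+z. \<integral>\<^sup>+x. f (z(p := x)) \<partial>std_normal_distribution \<partial>PiM (insert q I) (\<lambda>_. std_normal_distribution))"
      unfolding I(4) using I by (intro product_nn_integral_insert) auto
    also have "\<dots> = (\<integral>\<^sup>+z. \<integral>\<^sup>+y. \<integral>\<^sup>+x. f (z(q := y, p := x)) \<partial>std_normal_distribution \<partial>std_normal_distribution
        \<partial>PiM I (\<lambda>_. std_normal_distribution))"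
      using I by (intro product_nn_integral_insert) (auto intro: sigma_finite_measure.borel_measurable_nn_integral prob_space_imp_sigma_finite prob_space_std_normal)
    finally show ?thesis .
  qed
  have "emeasure (distr (std_gaussian n) (std_gaussian n) (givens p q c s)) A =
      (\<integral>\<^sup>+z. indicator A (givens p q c s z) \<partial>std_gaussian n)"
    by (subst nn_integral_indicator[symmetric], simp, subst nn_integral_distr) auto
  also have "\<dots> = (\<integral>\<^sup>+z. \<integral>\<^sup>+y. \<integral>\<^sup>+x. indicator A (givens p q c s (z(q := y, p := x)))
      \<partial>std_normal_distribution \<partial>std_normal_distribution \<partial>PiM I (\<lambda>_. std_normal_distribution))"
    by (rule iter) measurable
  also have "\<dots> = (\<integral>\<^sup>+z. \<integral>\<^sup>+y. \<integral>\<^sup>+x. indicator A (z(q := y, p := x))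
      \<partial>std_normal_distribution \<partial>std_normal_distribution \<partial>PiM I (\<lambda>_. std_normal_distribution))"
  proof (rule nn_integral_cong)
    fix z :: "nat \<Rightarrow> real"
    assume z: "z \<in> space (PiM I (\<lambda>_. std_normal_distribution))"
    let ?h = "\<lambda>u. indicator A (z(q := fst u, p := snd u)) :: ennreal"
    have upd: "(\<lambda>u. z(q := fst u, p := snd u)) \<in> measurable (borel \<Otimes>\<^sub>M borel) (std_gaussian n)"
    proof (rule measurable_PiM_single')
      fix l assume "l \<in> {..<n}"
      show "(\<lambda>u. (z(q := fst u, p := snd u)) l) \<in> measurable (borel \<Otimes>\<^sub>M borel) std_normal_distribution"
        by (cases "l = q"; cases "l = p") simp_all
    qed (use pq z I in \<open>auto simp: space_PiM PiE_iff extensional_def\<close>)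
    have h: "?h \<in> borel_measurable (borel \<Otimes>\<^sub>M borel)"
      by (rule measurable_compose[OF upd]) simp
    have "givens p q c s (z(q := y, p := x)) = z(q := c * y - s * x, p := c * x + s * y)" for x y
      using pq by (auto simp: givens_def)
    then show "(\<integral>\<^sup>+y. \<integral>\<^sup>+x. indicator A (givens p q c s (z(q := y, p := x))) \<partial>std_normal_distribution \<partial>std_normal_distribution) =
        (\<integral>\<^sup>+y. \<integral>\<^sup>+x. indicator A (z(q := y, p := x)) \<partial>std_normal_distribution \<partial>std_normal_distribution)"
      \<comment> \<open>The inner integral runs over \<open>x\<close>, so the pair is \<open>(y, x)\<close> and the angle changes sign.\<close>
      using std_normal_planar_rotation[OF h, of c "- s"] cs by (simp add: add.commute)
  qed
  also have "\<dots> = (\<integral>\<^sup>+z. indicator A z \<partial>std_gaussian n)"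
    by (rule iter[symmetric]) measurable
  finally show "emeasure (distr (std_gaussian n) (std_gaussian n) (givens p q c s)) A = emeasure (std_gaussian n) A"
    by simp
qed simp

lemma gauss_isometry_givens:
  assumes pq: "p < n" "q < n" "p \<noteq> q" and cs: "c\<^sup>2 + s\<^sup>2 = 1"
  shows "gauss_isometry n (givens p q c s)"
proof -
  have split: "(\<Sum>l<n. f l) = f p + (f q + (\<Sum>l\<in>{..<n} - {p} - {q}. f l))" for f :: "nat \<Rightarrow> real"
    using pq by (simp add: sum.remove[of _ p] sum.remove[of _ q])
  have "(\<Sum>l<n. givens p q c s x l * givens p q c s y l) = (\<Sum>l<n. x l * y l)" for x y
  proof -
    have "(c * x p + s * x q) * (c * y p + s * y q) + (c * x q - s * x p) * (c * y q - s * y p) =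
        (c\<^sup>2 + s\<^sup>2) * (x p * y p + x q * y q)"
      by (simp add: power2_eq_square algebra_simps)
    then have "(c * x p + s * x q) * (c * y p + s * y q) + (c * x q - s * x p) * (c * y q - s * y p) =
        x p * y p + x q * y q"
      using cs by simp
    moreover have "(\<Sum>l\<in>{..<n} - {p} - {q}. givens p q c s x l * givens p q c s y l) =
        (\<Sum>l\<in>{..<n} - {p} - {q}. x l * y l)"
      by (rule sum.cong) (auto simp: givens_def)
    ultimately show ?thesis
      unfolding split using pq by (simp add: givens_def)
  qed
  then show ?thesis
    unfolding gauss_isometry_def
    using measurable_givens[OF pq(1,2)] std_gaussian_givens[OF pq cs]
    by (auto simp: givens_def fun_eq_iff algebra_simps)
qed

lemma givens_eliminates:
  obtains c s :: real where "c\<^sup>2 + s\<^sup>2 = 1" "c * b - s * a = 0"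
proof (cases "a = 0 \<and> b = 0")
  case True
  then show ?thesis using that[of 1 0] by simp
next
  case False
  define r where "r = inverse (sqrt (a\<^sup>2 + b\<^sup>2))"
  have "(a * r)\<^sup>2 + (b * r)\<^sup>2 = (a\<^sup>2 + b\<^sup>2) * r\<^sup>2"
    by (simp add: power_mult_distrib distrib_right)
  also have "r\<^sup>2 = inverse (a\<^sup>2 + b\<^sup>2)"
    by (simp add: r_def power_inverse)
  also have "(a\<^sup>2 + b\<^sup>2) * inverse (a\<^sup>2 + b\<^sup>2) = 1"
    using False by (simp add: sum_power2_eq_zero_iff)
  finally have "(a * r)\<^sup>2 + (b * r)\<^sup>2 = 1" .
  moreover have "a * r * b - b * r * a = 0"
    by (simp only: mult.assoc mult.commute[of r] mult.left_commute) 
  ultimately show ?thesis by (rule that)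
qed

text \<open>
  Elimination of the entries \<open>p + 1, \<dots>, m - 1\<close> of a single vector, one Givens rotation for each.
  Every rotation involves coordinates from \<open>p\<close> on only, so vectors vanishing there still do so
  afterwards: this is what lets several vectors be treated in turn.
\<close>

lemma gauss_isometry_clear_between:
  assumes p: "p < n" and "m \<le> n"
  shows "\<exists>G. gauss_isometry n G \<and>
    (\<forall>z. (\<forall>l. p \<le> l \<longrightarrow> l < n \<longrightarrow> z l = 0) \<longrightarrow> (\<forall>l. p \<le> l \<longrightarrow> l < n \<longrightarrow> G z l = 0)) \<and>
    (\<forall>l. p < l \<longrightarrow> l < m \<longrightarrow> G y l = 0)"
  using assms(2)
proof (induction m)
  case 0
  show ?case by (rule exI[of _ "\<lambda>x. x"]) (simp add: gauss_isometry_id)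
next
  case (Suc m)
  then obtain G where G: "gauss_isometry n G"
      "\<forall>z. (\<forall>l. p \<le> l \<longrightarrow> l < n \<longrightarrow> z l = 0) \<longrightarrow> (\<forall>l. p \<le> l \<longrightarrow> l < n \<longrightarrow> G z l = 0)"
      "\<forall>l. p < l \<longrightarrow> l < m \<longrightarrow> G y l = 0"
    by auto
  show ?case
  proof (cases "p < m")
    case False
    with G show ?thesis by (intro exI[of _ G]) auto
  next
    case True
    obtain c s where cs: "c\<^sup>2 + s\<^sup>2 = 1" "c * G y m - s * G y p = 0"
      using givens_eliminates by blast
    have iso: "gauss_isometry n (\<lambda>x. givens p m c s (G x))"
      by (rule gauss_isometry_comp[OF gauss_isometry_givens G(1)]) (use True Suc.prems p cs in auto)
    have tail: "givens p m c s (G z) l = 0"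
      if z: "\<forall>l. p \<le> l \<longrightarrow> l < n \<longrightarrow> z l = 0" and l: "p \<le> l" "l < n" for z l
    proof -
      have "G z p = 0" "G z m = 0" "G z l = 0"
        using mp[OF spec[OF G(2), of z] z] l True Suc.prems p by simp_all
      then show ?thesis by (simp add: givens_def)
    qed
    have head: "givens p m c s (G y) l = 0" if "p < l" "l < Suc m" for l
      using G(3) cs(2) that by (cases "l = m") (simp_all add: givens_def)
    show ?thesis
    proof (rule exI[of _ "\<lambda>x. givens p m c s (G x)"], intro conjI allI impI)
      show "gauss_isometry n (\<lambda>x. givens p m c s (G x))"
        by (fact iso)
    next
      fix z :: "nat \<Rightarrow> real" and l
      assume z: "\<forall>l. p \<le> l \<longrightarrow> l < n \<longrightarrow> z l = 0" and l: "p \<le> l" "l < n"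
      show "givens p m c s (G z) l = 0"
        using z l by (rule tail)
    next
      fix l
      assume l: "p < l" "l < Suc m"
      show "givens p m c s (G y) l = 0"
        using l by (rule head)
    qed
  qed
qed

text \<open>
  Triangularisation of the matrix with columns \<open>x j\<close>, as in a QR decomposition. The vectors already
  moved into the first \<open>k\<close> coordinates stay there while the next one is cleared beyond coordinate \<open>k\<close>.
\<close>

lemma gauss_isometry_into_first_coordinates:
  fixes x :: "nat \<Rightarrow> nat \<Rightarrow> real"
  assumes "k \<le> n"
  obtains G where "gauss_isometry n G" "\<And>j l. j < k \<Longrightarrow> k \<le> l \<Longrightarrow> l < n \<Longrightarrow> G (x j) l = 0"
proof -
  have "\<exists>G. gauss_isometry n G \<and> (\<forall>j l. j < k \<longrightarrow> k \<le> l \<longrightarrow> l < n \<longrightarrow> G (x j) l = 0)"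
    using assms
  proof (induction k)
    case 0
    show ?case
      by (intro exI[of _ "\<lambda>x. x"]) (simp add: gauss_isometry_id)
  next
    case (Suc k)
    then have kn: "k < n"
      by simp
    obtain G where G: "gauss_isometry n G" "\<forall>j l. j < k \<longrightarrow> k \<le> l \<longrightarrow> l < n \<longrightarrow> G (x j) l = 0"
      using Suc.IH[OF less_imp_le[OF kn]] by (elim exE conjE) (rule that)
    obtain F where F: "gauss_isometry n F"
      "\<forall>z. (\<forall>l. k \<le> l \<longrightarrow> l < n \<longrightarrow> z l = 0) \<longrightarrow> (\<forall>l. k \<le> l \<longrightarrow> l < n \<longrightarrow> F z l = 0)"
      "\<forall>l. k < l \<longrightarrow> l < n \<longrightarrow> F (G (x k)) l = 0"
      using gauss_isometry_clear_between[OF kn order_refl, of "G (x k)"] by (elim exE conjE) (rule that)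
    have "F (G (x j)) l = 0" if "j < Suc k" "Suc k \<le> l" "l < n" for j l
    proof (cases "j = k")
      case True
      then show ?thesis using F(3) that by simp
    next
      case False
      then have "\<forall>l. k \<le> l \<longrightarrow> l < n \<longrightarrow> G (x j) l = 0"
        using G(2) that by simp
      from mp[OF spec[OF F(2), of "G (x j)"] this] show ?thesis
        using that by simp
    qed
    then show ?case
      by (intro exI[of _ "\<lambda>x. F (G x)"] conjI gauss_isometry_comp[OF F(1) G(1)] allI impI)
  qed
  then obtain G where G: "gauss_isometry n G" "\<forall>j l. j < k \<longrightarrow> k \<le> l \<longrightarrow> l < n \<longrightarrow> G (x j) l = 0"
    by (elim exE conjE) (rule that)
  show thesis
    by (rule that[OF G(1)]) (use G(2) in simp)
qed

lemma gauss_isometry_linear: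
  assumes "gauss_isometry n G"
  shows "G (\<lambda>l. a * x l + b * y l) = (\<lambda>l. a * G x l + b * G y l)"
proof -
  have "\<forall>a b x y. G (\<lambda>l. a * x l + b * y l) = (\<lambda>l. a * G x l + b * G y l)"
    using assms unfolding gauss_isometry_def by (elim conjE)
  then show ?thesis
    by - (drule spec[of _ a], drule spec[of _ b], drule spec[of _ x], erule spec[of _ y])
qed

lemma gauss_isometry_zero:
  assumes G: "gauss_isometry n G"
  shows "G (\<lambda>l. 0) = (\<lambda>l. 0)"
proof -
  have "G (\<lambda>l. 0 * 0 + 0 * 0) = (\<lambda>l. 0 * G (\<lambda>l. 0) l + 0 * G (\<lambda>l. 0) l)"
    by (rule gauss_isometry_linear[OF G])
  then show ?thesis unfolding mult_zero_left add_0_right .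
qed

lemma gauss_isometry_add_scaled:
  assumes G: "gauss_isometry n G"
  shows "G (\<lambda>l. x l * a + y l) = (\<lambda>l. G x l * a + G y l)"
proof -
  have "G (\<lambda>l. a * x l + 1 * y l) = (\<lambda>l. a * G x l + 1 * G y l)"
    by (rule gauss_isometry_linear[OF G])
  then show ?thesis unfolding mult_1 mult.commute[of a] .
qed

lemma gauss_isometry_sum:
  assumes G: "gauss_isometry n G" and J: "finite J"
  shows "G (\<lambda>l. \<Sum>j\<in>J. x j l * v j) = (\<lambda>l. \<Sum>j\<in>J. G (x j) l * v j)"
  using J
proof (induction J rule: finite_induct)
  case empty
  show ?case unfolding sum.empty by (rule gauss_isometry_zero[OF G])
next
  case (insert i J)
  have "G (\<lambda>l. \<Sum>j\<in>insert i J. x j l * v j) = G (\<lambda>l. x i l * v i + (\<Sum>j\<in>J. x j l * v j))"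
    unfolding sum.insert[OF insert.hyps] ..
  also have "\<dots> = (\<lambda>l. G (x i) l * v i + G (\<lambda>l. \<Sum>j\<in>J. x j l * v j) l)"
    by (rule gauss_isometry_add_scaled[OF G])
  also have "\<dots> = (\<lambda>l. \<Sum>j\<in>insert i J. G (x j) l * v j)"
    unfolding sum.insert[OF insert.hyps] insert.IH ..
  finally show ?case .
qed

section \<open>Least squares in rotated coordinates\<close>

text \<open>
  The rank is the size of a maximal independent set of columns; if it equals the number of columns,
  then these are distinct and independent.
\<close>

lemma full_rank_mult_vec_eq_0:
  fixes X :: "real mat"
  assumes X: "X \<in> carrier_mat n k" and rank: "vec_space.rank n X = k"
    and v: "v \<in> carrier_vec k" and Xv: "X *\<^sub>v v = 0\<^sub>v n"
  shows "v = 0\<^sub>v k"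
proof (rule ccontr)
  assume v0: "v \<noteq> 0\<^sub>v k"
  interpret vec_space "TYPE(real)" n .
  obtain S where S: "maximal S (\<lambda>T. T \<subseteq> set (cols X) \<and> lin_indpt T)"
    using maximal_exists[of "\<lambda>T. T \<subseteq> set (cols X) \<and> lin_indpt T" "card (set (cols X))" "{}"]
    by (meson List.finite_set card_mono empty_iff empty_subsetI finite_lin_indpt2 rev_finite_subset)
  have "k = card S"
    using rank_card_indpt[OF X S] rank by simp
  also have "\<dots> \<le> card (set (cols X))"
    using S by (intro card_mono) (auto simp: maximal_def)
  finally have "length (cols X) \<le> card (set (cols X))"
    using X by simp
  then have dist: "distinct (cols X)"
    using card_length[of "cols X"] by (intro card_distinct) simp
  show False
    using full_rank_lin_indpt[OF X rank dist] lin_depI[OF X v v0 Xv dist] by blast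
qed

lemma minv_eqI:
  assumes A: "A \<in> carrier_mat k k" and B: "B \<in> carrier_mat k k" and AB: "A * B = 1\<^sub>m k"
  shows "minv A = B"
proof -
  have BA: "B * A = 1\<^sub>m k"
    by (rule mat_mult_left_right_inverse[OF A B AB])
  have "A \<in> Units (ring_mat TYPE(real) k ())"
    using A B AB BA unfolding Units_def by (auto simp: ring_mat_simps)
  with mat_inverse(1)[OF A, where b = "()"] obtain C where C: "mat_inverse A = Some C"
    by (cases "mat_inverse A") auto
  note C' = mat_inverse(2)[OF A C]
  have "C = B * A * C"
    using left_mult_one_mat[of C k k] C' BA by simp
  also have "\<dots> = B * (A * C)"
    using A B C' by (intro assoc_mult_mat) auto
  also have "\<dots> = B"
    using B C' by simp
  finally show ?thesis
    using C by (simp add: minv_def)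
qed

lemma scalar_prod_self_eq_0:
  fixes y :: "real vec"
  assumes y: "y \<in> carrier_vec n" and yy: "y \<bullet> y = 0"
  shows "y = 0\<^sub>v n"
proof (rule eq_vecI)
  fix l assume "l < dim_vec (0\<^sub>v n :: real vec)"
  then have l: "l < n" by simp
  have "(\<Sum>l<n. y $ l * y $ l) = 0"
    using y yy by (simp add: scalar_prod_def lessThan_atLeast0)
  then have "y $ l * y $ l = 0"
    using l by (subst (asm) sum_nonneg_eq_0_iff) auto
  then show "y $ l = 0\<^sub>v n $ l"
    using l by simp
qed (use y in simp)

text \<open>
  The Gram matrix is invertible since \<open>v \<bullet> X\<^sup>T X v\<close> is the squared norm of \<open>X v\<close>.
\<close>

lemma gram_inverse:
  fixes X :: "real mat"
  assumes X: "X \<in> carrier_mat n k" and rank: "vec_space.rank n X = k"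
  shows "minv (transpose_mat X * X) \<in> carrier_mat k k"
    and "(transpose_mat X * X) * minv (transpose_mat X * X) = 1\<^sub>m k"
    and "minv (transpose_mat X * X) * (transpose_mat X * X) = 1\<^sub>m k"
proof -
  let ?A = "transpose_mat X * X"
  have A: "?A \<in> carrier_mat k k"
    using X by simp
  have "det ?A \<noteq> 0"
  proof
    assume "det ?A = 0"
    then obtain v where v: "v \<in> carrier_vec k" "v \<noteq> 0\<^sub>v k" "?A *\<^sub>v v = 0\<^sub>v k"
      using det_0_iff_vec_prod_zero[OF A] by auto
    have Xv: "X *\<^sub>v v \<in> carrier_vec n"
      using X v by simp
    have "(X *\<^sub>v v) \<bullet> (X *\<^sub>v v) = v \<bullet> (transpose_mat X *\<^sub>v (X *\<^sub>v v))"
      using transpose_vec_mult_scalar[OF X v(1) Xv] comm_scalar_prod[of v k] X v Xv by simp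
    also have "transpose_mat X *\<^sub>v (X *\<^sub>v v) = ?A *\<^sub>v v"
      using X v by (intro assoc_mult_mat_vec[symmetric]) auto
    also have "v \<bullet> \<dots> = 0"
      using v by simp
    finally have "X *\<^sub>v v = 0\<^sub>v n"
      by (rule scalar_prod_self_eq_0[OF Xv])
    with full_rank_mult_vec_eq_0[OF X rank v(1)] v(2) show False
      by simp
  qed
  then have "?A \<in> Units (ring_mat TYPE(real) k ())"
    by (rule det_non_zero_imp_unit[OF A])
  with mat_inverse(1)[OF A, where b = "()"] obtain C where C: "mat_inverse ?A = Some C"
    by (cases "mat_inverse ?A") auto
  show "minv ?A \<in> carrier_mat k k" "?A * minv ?A = 1\<^sub>m k" "minv ?A * ?A = 1\<^sub>m k"
    using mat_inverse(2)[OF A C] C by (simp_all add: minv_def)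
qed

lemma minv_smult:
  assumes A: "A \<in> carrier_mat k k" and inv: "minv A \<in> carrier_mat k k" "A * minv A = 1\<^sub>m k"
    and c: "c \<noteq> 0"
  shows "minv (c \<cdot>\<^sub>m A) = (1 / c) \<cdot>\<^sub>m minv A"
proof (rule minv_eqI)
  have "c \<cdot>\<^sub>m A * ((1 / c) \<cdot>\<^sub>m minv A) = c \<cdot>\<^sub>m (A * ((1 / c) \<cdot>\<^sub>m minv A))"
    using A inv by (intro mult_smult_assoc_mat) auto
  also have "A * ((1 / c) \<cdot>\<^sub>m minv A) = (1 / c) \<cdot>\<^sub>m (A * minv A)"
    using A inv by (intro mult_smult_distrib) auto
  finally show "c \<cdot>\<^sub>m A * ((1 / c) \<cdot>\<^sub>m minv A) = 1\<^sub>m k"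
    using inv(2) c by (intro eq_matI) auto
qed (use A inv in auto)

lemma gauss_isometry_scalar_prod:
  "gauss_isometry n G \<Longrightarrow> (\<Sum>l<n. G x l * G y l) = (\<Sum>l<n. x l * y l)"
  by (simp add: gauss_isometry_def)

lemma gauss_isometry_scale: "gauss_isometry n G \<Longrightarrow> G (\<lambda>l. a * x l) = (\<lambda>l. a * G x l)"
  using gauss_isometry_linear[of n G a x 0 x] by simp

lemma mult_mat_vec_index_sum:
  "A \<in> carrier_mat m k \<Longrightarrow> v \<in> carrier_vec k \<Longrightarrow> l < m \<Longrightarrow> (A *\<^sub>v v) $ l = (\<Sum>j<k. A $$ (l, j) * v $ j)"
  by (auto simp: scalar_prod_def lessThan_atLeast0 intro!: sum.cong)

lemma mult_mat_index_sum:
  "A \<in> carrier_mat m k \<Longrightarrow> B \<in> carrier_mat k p \<Longrightarrow> l < m \<Longrightarrow> j < p \<Longrightarrow>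
    (A * B) $$ (l, j) = (\<Sum>q<k. A $$ (l, q) * B $$ (q, j))"
  by (auto simp: scalar_prod_def lessThan_atLeast0 intro!: sum.cong)

lemma sum_split_at: "(k :: nat) \<le> n \<Longrightarrow> (\<Sum>l<n. f l) = (\<Sum>l<k. f l) + (\<Sum>l\<in>{k..<n}. f l :: real)"
  using sum.atLeastLessThan_concat[of 0 k n f] by (simp add: lessThan_atLeast0)

text \<open>
  Let \<open>G\<close> move the columns of \<open>X\<close> into the first \<open>k\<close> coordinates, and let \<open>B\<close> be the upper \<open>k\<close> by
  \<open>k\<close> block of the rotated matrix. Since \<open>G\<close> preserves scalar products, \<open>B\<^sup>T B = X\<^sup>T X\<close>, so \<open>B\<close> is
  invertible; hence the fitted error \<open>X w\<close> rotates to the first \<open>k\<close> entries of \<open>G u\<close>, and the residual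
  to the others. The \<open>i\<close>-th estimation error is the scalar product of \<open>u\<close> with the row \<open>i\<close> of
  \<open>(X\<^sup>T X)\<^sup>-\<^sup>1 X\<^sup>T\<close>. That row lies in the column space, so \<open>G\<close> confines it to the first \<open>k\<close>
  coordinates; its squared length is the diagonal entry of \<open>(X\<^sup>T X)\<^sup>-\<^sup>1\<close>, which is \<open>\<xi>\<^sup>2 / n\<close>.
\<close>

lemma least_squares_rotated:
  fixes X :: "real mat"
  assumes X: "X \<in> carrier_mat n k" and rank: "vec_space.rank n X = k" and kn: "k \<le> n"
  obtains G where "gauss_isometry n G"
    and "\<And>i. i < k \<Longrightarrow> xi X i > 0"
    and "\<And>i. i < k \<Longrightarrow> \<exists>b. (\<Sum>l<k. (b l)\<^sup>2) = 1 \<and>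
      (\<forall>\<theta> u. \<theta> \<in> carrier_vec k \<longrightarrow> u \<in> carrier_vec n \<longrightarrow>
        theta_LS X (X *\<^sub>v \<theta> + u) $ i = \<theta> $ i + xi X i / sqrt n * (\<Sum>l<k. b l * G (($) u) l))"
    and "\<And>\<theta> u. \<theta> \<in> carrier_vec k \<Longrightarrow> u \<in> carrier_vec n \<Longrightarrow>
      sigma_hat X (X *\<^sub>v \<theta> + u) = sqrt ((\<Sum>l\<in>{k..<n}. (G (($) u) l)\<^sup>2) / (real n - real k))"
proof -
  define A where "A = transpose_mat X * X"
  define N where "N = minv A"
  define W where "W = N * transpose_mat X"
  define x where "x j l = X $$ (l, j)" for j l
  note inv = gram_inverse[OF X rank, folded A_def, folded N_def]
  have Ac: "A \<in> carrier_mat k k" and Wc: "W \<in> carrier_mat k n" and Xt: "transpose_mat X \<in> carrier_mat k n"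
    using X inv by (simp_all add: A_def W_def)
  have WX: "W * X = 1\<^sub>m k"
    using inv(3) unfolding W_def A_def by (subst assoc_mult_mat[OF inv(1) Xt X]) 
  obtain G where G: "gauss_isometry n G" and Gx: "\<And>j l. j < k \<Longrightarrow> k \<le> l \<Longrightarrow> l < n \<Longrightarrow> G (x j) l = 0"
    using gauss_isometry_into_first_coordinates[OF kn, of x] by blast
  have LS: "theta_LS X (X *\<^sub>v \<theta> + u) = \<theta> + W *\<^sub>v u" if "\<theta> \<in> carrier_vec k" "u \<in> carrier_vec n" for \<theta> u
  proof -
    have "theta_LS X (X *\<^sub>v \<theta> + u) = W *\<^sub>v (X *\<^sub>v \<theta>) + W *\<^sub>v u"
      unfolding theta_LS_def A_def[symmetric] N_def[symmetric] W_def[symmetric]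
      using X Wc that by (intro mult_add_distrib_mat_vec) auto
    also have "W *\<^sub>v (X *\<^sub>v \<theta>) = (W * X) *\<^sub>v \<theta>"
      using X Wc that by (intro assoc_mult_mat_vec[symmetric]) auto
    finally show ?thesis
      using that by (simp add: WX)
  qed
  have W_row: "W $$ (i, l) = (\<Sum>j<k. x j l * N $$ (i, j))" if "i < k" "l < n" for i l
    using mult_mat_index_sum[OF inv(1) Xt that] X that
    by (simp add: W_def x_def mult.commute)
  have GW: "G (\<lambda>l. \<Sum>j<k. x j l * N $$ (i, j)) l = 0" if "k \<le> l" "l < n" for i l
    using gauss_isometry_sum[OF G, of "{..<k}" x] Gx that by simp
  have norm_W: "(\<Sum>l<n. (W $$ (i, l))\<^sup>2) = N $$ (i, i)" and N_pos: "N $$ (i, i) > 0" if i: "i < k" for i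
  proof -
    have "W * transpose_mat W = W * (X * transpose_mat N)"
      using inv(1) X by (simp add: W_def transpose_mult[OF inv(1) Xt])
    also have "\<dots> = (W * X) * transpose_mat N"
      using inv(1) X Wc by (intro assoc_mult_mat[symmetric]) auto
    also have "\<dots> = transpose_mat N"
      using inv(1) by (simp add: WX)
    finally have "(W * transpose_mat W) $$ (i, i) = N $$ (i, i)"
      using i inv(1) by simp
    then show *: "(\<Sum>l<n. (W $$ (i, l))\<^sup>2) = N $$ (i, i)"
      using mult_mat_index_sum[OF Wc, of "transpose_mat W" k i i] Wc i by (simp add: power2_eq_square)
    have "(\<Sum>l<n. W $$ (i, l) * X $$ (l, i)) = 1"
      using mult_mat_index_sum[OF Wc X i i] WX i by simp
    then obtain l where "l < n" "W $$ (i, l) \<noteq> 0"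
      by (metis (no_types, lifting) lessThan_iff mult_zero_left sum.neutral zero_neq_one)
    then have "(\<Sum>l<n. (W $$ (i, l))\<^sup>2) > 0"
      by (intro sum_pos2[of _ l]) auto
    then show "N $$ (i, i) > 0"
      by (simp add: *)
  qed
  have n0: "n > 0" if "i < k" for i
    using that kn by simp
  have xi_eq: "xi X i = sqrt (real n * N $$ (i, i))" if i: "i < k" for i
  proof -
    have "minv ((1 / real n) \<cdot>\<^sub>m A) = (1 / (1 / real n)) \<cdot>\<^sub>m N"
      unfolding N_def using inv n0[OF i] by (intro minv_smult[OF Ac]) (auto simp: N_def)
    then show ?thesis
      using X i inv(1) by (simp add: xi_def A_def)
  qed
  show thesis
  proof (rule that[OF G])
    fix i assume i: "i < k"
    show "xi X i > 0"
      using xi_eq[OF i] N_pos[OF i] n0[OF i] by simp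
    define b where "b l = G (\<lambda>l. \<Sum>j<k. x j l * N $$ (i, j)) l / sqrt (N $$ (i, i))" for l
    have Wu: "(\<Sum>l<k. b l * G y l) = (\<Sum>l<n. W $$ (i, l) * y l) / sqrt (N $$ (i, i))" for y
    proof -
      have "(\<Sum>l<n. W $$ (i, l) * y l) = (\<Sum>l<n. (\<Sum>j<k. x j l * N $$ (i, j)) * y l)"
        using W_row[OF i] by (intro sum.cong) auto
      also have "\<dots> = (\<Sum>l<n. G (\<lambda>l. \<Sum>j<k. x j l * N $$ (i, j)) l * G y l)"
        by (rule gauss_isometry_scalar_prod[OF G, symmetric])
      also have "\<dots> = (\<Sum>l<k. G (\<lambda>l. \<Sum>j<k. x j l * N $$ (i, j)) l * G y l)"
        unfolding sum_split_at[OF kn] by (simp add: GW)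
      finally show ?thesis
        by (simp add: b_def sum_divide_distrib)
    qed
    have "(\<Sum>l<k. (b l)\<^sup>2) = (\<Sum>l<k. b l * G (\<lambda>l. \<Sum>j<k. x j l * N $$ (i, j)) l) / sqrt (N $$ (i, i))"
      by (simp add: b_def sum_divide_distrib power2_eq_square)
    also have "\<dots> = (\<Sum>l<n. (W $$ (i, l))\<^sup>2) / (sqrt (N $$ (i, i)))\<^sup>2"
      unfolding Wu using W_row[OF i] by (simp add: power2_eq_square)
    also have "\<dots> = 1"
      using norm_W[OF i] N_pos[OF i] by simp
    finally have b1: "(\<Sum>l<k. (b l)\<^sup>2) = 1" .
    have "theta_LS X (X *\<^sub>v \<theta> + u) $ i = \<theta> $ i + xi X i / sqrt n * (\<Sum>l<k. b l * G (($) u) l)"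
      if "\<theta> \<in> carrier_vec k" "u \<in> carrier_vec n" for \<theta> u
    proof -
      have "theta_LS X (X *\<^sub>v \<theta> + u) $ i = \<theta> $ i + (\<Sum>l<n. W $$ (i, l) * u $ l)"
        unfolding LS[OF that] using that Wc i mult_mat_vec_index_sum[OF Wc that(2) i] by simp
      then show ?thesis
        using Wu[of "($) u"] xi_eq[OF i] N_pos[OF i] n0[OF i] by (simp add: real_sqrt_mult)
    qed
    with b1 show "\<exists>b. (\<Sum>l<k. (b l)\<^sup>2) = 1 \<and>
      (\<forall>\<theta> u. \<theta> \<in> carrier_vec k \<longrightarrow> u \<in> carrier_vec n \<longrightarrow>
        theta_LS X (X *\<^sub>v \<theta> + u) $ i = \<theta> $ i + xi X i / sqrt n * (\<Sum>l<k. b l * G (($) u) l))"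
      by (intro exI[of _ b] conjI allI impI)
  next
    fix \<theta> u :: "real vec"
    assume th: "\<theta> \<in> carrier_vec k" and u: "u \<in> carrier_vec n"
    define w where "w = W *\<^sub>v u"
    have w: "w \<in> carrier_vec k"
      using Wc u by (simp add: w_def)
    define B where "B = mat k k (\<lambda>(l, j). G (x j) l)"
    define g where "g = vec k (G (($) u))"
    have B: "B \<in> carrier_mat k k" and g: "g \<in> carrier_vec k"
      by (simp_all add: B_def g_def)
    have BB: "transpose_mat B * B = A"
    proof (rule eq_matI)
      fix p q assume pq: "p < dim_row A" "q < dim_col A"
      then have pq': "p < k" "q < k"
        using Ac by auto
      have "(transpose_mat B * B) $$ (p, q) = (\<Sum>l<k. G (x p) l * G (x q) l)"
        using mult_mat_index_sum[of "transpose_mat B" k k B k p q] B pq' by (simp add: B_def)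
      also have "\<dots> = (\<Sum>l<n. G (x p) l * G (x q) l)"
        unfolding sum_split_at[OF kn] using Gx pq' by simp
      also have "\<dots> = (\<Sum>l<n. x p l * x q l)"
        by (rule gauss_isometry_scalar_prod[OF G])
      also have "\<dots> = A $$ (p, q)"
        using mult_mat_index_sum[OF Xt X pq'] X pq' by (simp add: A_def x_def)
      finally show "(transpose_mat B * B) $$ (p, q) = A $$ (p, q)" .
    qed (use Ac B in auto)
    have Bg: "transpose_mat B *\<^sub>v g = transpose_mat X *\<^sub>v u"
    proof (rule eq_vecI)
      fix p assume "p < dim_vec (transpose_mat X *\<^sub>v u)"
      then have p: "p < k" using X by simp
      have "(transpose_mat B *\<^sub>v g) $ p = (\<Sum>l<k. G (x p) l * G (($) u) l)"
        using mult_mat_vec_index_sum[of "transpose_mat B" k k g p] B g p by (simp add: B_def g_def)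
      also have "\<dots> = (\<Sum>l<n. G (x p) l * G (($) u) l)"
        unfolding sum_split_at[OF kn] using Gx p by simp
      also have "\<dots> = (\<Sum>l<n. x p l * u $ l)"
        by (rule gauss_isometry_scalar_prod[OF G])
      also have "\<dots> = (transpose_mat X *\<^sub>v u) $ p"
        using mult_mat_vec_index_sum[OF Xt u p] X p by (simp add: x_def)
      finally show "(transpose_mat B *\<^sub>v g) $ p = (transpose_mat X *\<^sub>v u) $ p" .
    qed (use B X in auto)
    have NB: "N * transpose_mat B \<in> carrier_mat k k"
      using inv(1) B by simp
    \<comment> \<open>A left inverse of a square matrix is a right inverse, so \<open>B\<close> maps \<open>w\<close> onto the head of the rotated error.\<close>
    have "(N * transpose_mat B) * B = 1\<^sub>m k"
      using inv B BB by (subst assoc_mult_mat[of _ k k _ k _ k]) auto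
    then have BNB: "B * (N * transpose_mat B) = 1\<^sub>m k"
      by (rule mat_mult_left_right_inverse[OF NB B])
    have "w = N *\<^sub>v (transpose_mat X *\<^sub>v u)"
      unfolding w_def W_def by (rule assoc_mult_mat_vec[OF inv(1) Xt u])
    also have "\<dots> = (N * transpose_mat B) *\<^sub>v g"
      unfolding Bg[symmetric] using assoc_mult_mat_vec[of N k k "transpose_mat B" k g] inv(1) B g by simp
    finally have "B *\<^sub>v w = (B * (N * transpose_mat B)) *\<^sub>v g"
      using assoc_mult_mat_vec[OF B NB g] by simp
    then have Bw: "B *\<^sub>v w = g"
      using g by (simp add: BNB)
    define r where "r l = u $ l - (\<Sum>j<k. x j l * w $ j)" for l
    have res: "(X *\<^sub>v \<theta> + u) - X *\<^sub>v theta_LS X (X *\<^sub>v \<theta> + u) = vec n r"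
    proof (rule eq_vecI)
      fix l assume "l < dim_vec (vec n r)"
      then have l: "l < n" by simp
      have "X *\<^sub>v (\<theta> + w) = X *\<^sub>v \<theta> + X *\<^sub>v w"
        by (rule mult_add_distrib_mat_vec[OF X th w])
      then show "((X *\<^sub>v \<theta> + u) - X *\<^sub>v theta_LS X (X *\<^sub>v \<theta> + u)) $ l = vec n r $ l"
        unfolding LS[OF th u] w_def[symmetric]
        using X u l mult_mat_vec_index_sum[OF X w l] by (simp add: r_def x_def)
    qed (use X u in simp)
    have "G r = G (\<lambda>l. 1 * u $ l + (- 1) * (\<Sum>j<k. x j l * w $ j))"
      by (simp add: r_def[abs_def])
    also have "\<dots> = (\<lambda>l. 1 * G (($) u) l + (- 1) * G (\<lambda>l. \<Sum>j<k. x j l * w $ j) l)"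
      by (rule gauss_isometry_linear[OF G])
    also have "G (\<lambda>l. \<Sum>j<k. x j l * w $ j) = (\<lambda>l. \<Sum>j<k. G (x j) l * w $ j)"
      by (rule gauss_isometry_sum[OF G]) simp
    finally have Gr: "G r l = G (($) u) l - (\<Sum>j<k. G (x j) l * w $ j)" for l
      by simp
    have Gr_low: "G r l = 0" if "l < k" for l
    proof -
      have "(\<Sum>j<k. G (x j) l * w $ j) = (B *\<^sub>v w) $ l"
        using mult_mat_vec_index_sum[OF B w that] that by (simp add: B_def)
      then show ?thesis
        using that by (simp add: Gr Bw g_def)
    qed
    have Gr_high: "G r l = G (($) u) l" if "k \<le> l" "l < n" for l
      using that Gx by (simp add: Gr)
    have "vec n r \<bullet> vec n r = (\<Sum>l<n. r l * r l)"
      by (simp add: scalar_prod_def lessThan_atLeast0)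
    also have "\<dots> = (\<Sum>l<n. G r l * G r l)"
      by (rule gauss_isometry_scalar_prod[OF G, symmetric])
    also have "\<dots> = (\<Sum>l\<in>{k..<n}. (G (($) u) l)\<^sup>2)"
      unfolding sum_split_at[OF kn] using Gr_low Gr_high by (simp add: power2_eq_square)
    finally show "sigma_hat X (X *\<^sub>v \<theta> + u) = sqrt ((\<Sum>l\<in>{k..<n}. (G (($) u) l)\<^sup>2) / (real n - real k))"
      unfolding sigma_hat_def res using X by simp
  qed
qed

section \<open>The joint law of the estimators\<close>

text \<open>
  The difference of the two vectors has norm zero on the first \<open>n\<close> coordinates, hence so has its
  image. Entries from \<open>n\<close> on thus never influence the coordinates of interest.
\<close>

lemma gauss_isometry_local:
  assumes G: "gauss_isometry n G" and eq: "\<And>l. l < n \<Longrightarrow> x l = y l" and l: "l < n"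
  shows "G x l = G y l"
proof -
  define d where "d l = 1 * x l + (- 1) * y l" for l
  have Gd: "G d = (\<lambda>l. 1 * G x l + (- 1) * G y l)"
    unfolding d_def by (rule gauss_isometry_linear[OF G])
  have "(\<Sum>l<n. G d l * G d l) = (\<Sum>l<n. d l * d l)"
    by (rule gauss_isometry_scalar_prod[OF G])
  also have "\<dots> = 0"
    using eq by (simp add: d_def)
  finally have "G d l * G d l = 0"
    using l by (subst (asm) sum_nonneg_eq_0_iff) auto
  then show ?thesis
    by (simp add: Gd)
qed

lemma indep_vars_std_gaussian:
  assumes n: "n > 0"
  shows "prob_space.indep_vars (std_gaussian n) (\<lambda>_. borel) (\<lambda>l g. g l) {..<n}"
    and "\<And>l. l < n \<Longrightarrow> distr (std_gaussian n) borel (\<lambda>g. g l) = std_normal_distribution"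
proof -
  interpret prob_space "std_gaussian n"
    by (rule prob_space_std_gaussian)
  show comp: "distr (std_gaussian n) borel (\<lambda>g. g l) = std_normal_distribution" if "l < n" for l
  proof -
    have "distr (std_gaussian n) borel (\<lambda>g. g l) = distr (std_gaussian n) std_normal_distribution (\<lambda>g. g l)"
      by (rule distr_cong) auto
    also have "\<dots> = std_normal_distribution"
      using that by (intro distr_PiM_component prob_space_std_normal) auto
    finally show ?thesis .
  qed
  have "distr (std_gaussian n) (PiM {..<n} (\<lambda>_. borel)) (\<lambda>g. \<lambda>l\<in>{..<n}. g l) =
      distr (std_gaussian n) (std_gaussian n) (\<lambda>g. g)"
    by (rule distr_cong) (auto simp: space_PiM PiE_iff extensional_def fun_eq_iff intro!: sets_PiM_cong)
  also have "\<dots> = PiM {..<n} (\<lambda>l. distr (std_gaussian n) borel (\<lambda>g. g l))"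
    by (subst distr_id) (rule PiM_cong, simp_all add: comp)
  finally show "indep_vars (\<lambda>_. borel) (\<lambda>l g. g l) {..<n}"
    using n by (subst indep_vars_iff_distr_eq_PiM') auto
qed

text \<open>
  The terms with \<open>b l = 0\<close> are dropped first: they are degenerate, whereas the convolution of normal
  laws requires positive variances.
\<close>

lemma distr_unit_combination_std_gaussian:
  assumes kn: "k \<le> n" and b: "(\<Sum>l<k. (b l)\<^sup>2) = 1"
  shows "distr (std_gaussian n) borel (\<lambda>g. \<Sum>l<k. b l * g l) = std_normal_distribution"
proof -
  interpret prob_space "std_gaussian n"
    by (rule prob_space_std_gaussian)
  let ?L = "{l. l < k \<and> b l \<noteq> 0}"
  have L_sum: "(\<Sum>l<k. f l) = (\<Sum>l\<in>?L. f l)" if "\<And>l. b l = 0 \<Longrightarrow> f l = 0" for f :: "nat \<Rightarrow> real"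
    by (rule sum.mono_neutral_right) (use that in auto)
  have L: "?L \<noteq> {}"
  proof
    assume "?L = {}"
    with L_sum[of "\<lambda>l. (b l)\<^sup>2"] b show False
      by simp
  qed
  then have n: "n > 0"
    using kn by auto
  have "distributed (std_gaussian n) lborel (\<lambda>g. b l * g l) (normal_density 0 \<bar>b l\<bar>)" if l: "l \<in> ?L" for l
  proof -
    have "(\<lambda>g. g l) \<in> borel_measurable (std_gaussian n)"
      using indep_vars_std_gaussian(1)[OF n] l kn by (simp add: indep_vars_def)
    then have "distributed (std_gaussian n) lborel (\<lambda>g. g l) std_normal_density"
      using indep_vars_std_gaussian(2)[OF n, of l] l kn
        distr_cong[OF refl sets_lborel refl, of "std_gaussian n" "\<lambda>g. g l"]
      by (simp add: distributed_def)
    from normal_density_affine[OF this, of "b l" 0] show ?thesis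
      using l by simp
  qed
  moreover have "indep_vars (\<lambda>_. borel) (\<lambda>l g. b l * g l) ?L"
    by (rule indep_vars_subset[OF indep_vars_compose2[OF indep_vars_std_gaussian(1)[OF n]]])
      (use kn in auto)
  ultimately have "distributed (std_gaussian n) lborel (\<lambda>g. \<Sum>l\<in>?L. b l * g l)
      (normal_density (\<Sum>l\<in>?L. 0) (sqrt (\<Sum>l\<in>?L. \<bar>b l\<bar>\<^sup>2)))"
    using L by (intro sum_indep_normal) auto
  moreover have "(\<Sum>l\<in>?L. \<bar>b l\<bar>\<^sup>2) = 1"
    using b L_sum[of "\<lambda>l. (b l)\<^sup>2"] by simp
  ultimately have "distr (std_gaussian n) lborel (\<lambda>g. \<Sum>l\<in>?L. b l * g l) = std_normal_distribution"
    by (simp add: distributed_def)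
  then show ?thesis
    using distr_cong[OF refl sets_lborel refl, of "std_gaussian n" "\<lambda>g. \<Sum>l\<in>?L. b l * g l"]
    by (subst L_sum) auto
qed

lemma distr_tail_norm_std_gaussian:
  assumes kn: "k < n"
  shows "distr (std_gaussian n) borel (\<lambda>g. sqrt ((\<Sum>l\<in>{k..<n}. (g l)\<^sup>2) / (real n - real k))) =
    scaled_chi_distribution (n - k)"
proof -
  let ?m = "n - k"
  let ?t = "\<lambda>g. \<lambda>j\<in>{..<?m}. g (k + j)"
  let ?h = "\<lambda>z::nat \<Rightarrow> real. sqrt (\<Sum>j<?m. (z j)\<^sup>2) / sqrt (real ?m)"
  have t: "distr (std_gaussian n) (std_gaussian ?m) ?t = std_gaussian ?m"
    by (rule distr_PiM_reindex) (auto simp: inj_on_def prob_space_std_normal)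
  have m: "?t \<in> measurable (std_gaussian n) (std_gaussian ?m)"
    by (intro measurable_restrict measurable_component_singleton) auto
  have h: "?h \<in> borel_measurable (std_gaussian ?m)"
    by measurable
  have "scaled_chi_distribution ?m = distr (std_gaussian n) borel (?h \<circ> ?t)"
    unfolding scaled_chi_distribution_def by (subst t[symmetric], rule distr_distr[OF h m])
  also have "?h \<circ> ?t = (\<lambda>g. sqrt ((\<Sum>l\<in>{k..<n}. (g l)\<^sup>2) / (real n - real k)))"
  proof
    fix g :: "nat \<Rightarrow> real"
    have "(\<Sum>l\<in>{k..<n}. (g l)\<^sup>2) = (\<Sum>j<?m. (g (k + j))\<^sup>2)"
      by (simp add: sum.atLeastLessThan_shift_0[of _ k n] lessThan_atLeast0)
    then show "(?h \<circ> ?t) g = sqrt ((\<Sum>l\<in>{k..<n}. (g l)\<^sup>2) / (real n - real k))"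
      using kn by (simp add: real_sqrt_divide of_nat_diff)
  qed
  finally show ?thesis ..
qed

text \<open>
  The two components are functions of disjoint blocks of coordinates, hence independent.
\<close>

lemma distr_combination_tail_norm_std_gaussian:
  assumes kn: "k < n" and b: "(\<Sum>l<k. (b l)\<^sup>2) = 1"
  shows "distr (std_gaussian n) (borel \<Otimes>\<^sub>M borel)
      (\<lambda>g. (\<Sum>l<k. b l * g l, sqrt ((\<Sum>l\<in>{k..<n}. (g l)\<^sup>2) / (real n - real k)))) =
    std_normal_distribution \<Otimes>\<^sub>M scaled_chi_distribution (n - k)"
proof -
  interpret prob_space "std_gaussian n"
    by (rule prob_space_std_gaussian)
  let ?Z = "\<lambda>g. \<Sum>l<k. b l * g l" and ?S = "\<lambda>g. sqrt ((\<Sum>l\<in>{k..<n}. (g l)\<^sup>2) / (real n - real k))"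
  have n: "n > 0"
    using kn by simp
  have "indep_var (PiM {..<k} (\<lambda>_. borel)) (\<lambda>g. restrict (\<lambda>l. g l) {..<k})
      (PiM {k..<n} (\<lambda>_. borel)) (\<lambda>g. restrict (\<lambda>l. g l) {k..<n})"
    using kn by (intro indep_var_restrict[OF indep_vars_std_gaussian(1)[OF n]]) auto
  then have "indep_var borel (?Z \<circ> (\<lambda>g. restrict (\<lambda>l. g l) {..<k})) borel (?S \<circ> (\<lambda>g. restrict (\<lambda>l. g l) {k..<n}))"
    by (rule indep_var_compose) measurable
  then have "indep_var borel ?Z borel ?S"
    by (simp add: comp_def)
  then have "distr (std_gaussian n) borel ?Z \<Otimes>\<^sub>M distr (std_gaussian n) borel ?S =
      distr (std_gaussian n) (borel \<Otimes>\<^sub>M borel) (\<lambda>g. (?Z g, ?S g))"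
    by (simp add: indep_var_distribution_eq)
  then show ?thesis
    using distr_unit_combination_std_gaussian[OF less_imp_le[OF kn] b] distr_tail_norm_std_gaussian[OF kn] by simp
qed

lemma gaussian_linear_model_joint_law:
  assumes model: "gaussian_linear_model M X Y \<theta> \<sigma>" and X: "X \<in> carrier_mat n k"
    and rank: "vec_space.rank n X = k" and kn: "k < n" and i: "i < k"
    and th: "\<theta> \<in> carrier_vec k" and \<sigma>: "\<sigma> > 0"
  obtains Z S where "prob_space M" "xi X i > 0"
    and "Z \<in> borel_measurable M" "S \<in> borel_measurable M"
    and "distr M (borel \<Otimes>\<^sub>M borel) (\<lambda>\<omega>. (Z \<omega>, S \<omega>)) =
      std_normal_distribution \<Otimes>\<^sub>M scaled_chi_distribution (n - k)"
    and "\<And>\<omega>. \<omega> \<in> space M \<Longrightarrow> theta_LS X (Y \<omega>) $ i = \<theta> $ i + \<sigma> * xi X i / sqrt n * Z \<omega>"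
    and "\<And>\<omega>. \<omega> \<in> space M \<Longrightarrow> sigma_hat X (Y \<omega>) = \<sigma> * S \<omega>"
proof -
  interpret prob_space M
    using model by (simp add: gaussian_linear_model_def)
  have dim: "dim_row X = n"
    using X by simp
  from model obtain u where u: "\<And>\<omega>. \<omega> \<in> space M \<Longrightarrow> u \<omega> \<in> carrier_vec n \<and> Y \<omega> = X *\<^sub>v \<theta> + u \<omega>"
    and ind: "indep_vars (\<lambda>_. borel) (\<lambda>j \<omega>. u \<omega> $ j) {..<n}"
    and nrm: "\<And>j. j < n \<Longrightarrow> distributed M lborel (\<lambda>\<omega>. u \<omega> $ j) (normal_density 0 \<sigma>)"
    unfolding gaussian_linear_model_def dim by blast
  let ?g = "\<lambda>\<omega>. \<lambda>l\<in>{..<n}. u \<omega> $ l / \<sigma>"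
  have ind': "indep_vars (\<lambda>_. borel) (\<lambda>j \<omega>. u \<omega> $ j / \<sigma>) {..<n}"
    using indep_vars_compose2[OF ind, of "\<lambda>_ x. x / \<sigma>" "\<lambda>_. borel"] by simp
  have std: "distr M borel (\<lambda>\<omega>. u \<omega> $ j / \<sigma>) = std_normal_distribution" if "j < n" for j
  proof -
    have "distributed M lborel (\<lambda>\<omega>. (u \<omega> $ j - 0) / \<sigma>) std_normal_density"
      using nrm[OF that] normal_standard_normal_convert[OF \<sigma>, of "\<lambda>\<omega>. u \<omega> $ j" 0] by simp
    then have "distr M lborel (\<lambda>\<omega>. u \<omega> $ j / \<sigma>) = std_normal_distribution"
      by (simp add: distributed_def)
    then show ?thesis
      using distr_cong[OF refl sets_lborel refl, of M "\<lambda>\<omega>. u \<omega> $ j / \<sigma>"] by simp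
  qed
  have g: "?g \<in> measurable M (std_gaussian n)"
  proof -
    have "?g \<in> measurable M (PiM {..<n} (\<lambda>_. borel))"
      using ind' by (intro measurable_restrict) (simp add: indep_vars_def)
    then show ?thesis
      by (subst measurable_cong_sets[OF refl sets_PiM_cong[OF refl]]) auto
  qed
  have law_g: "distr M (std_gaussian n) ?g = std_gaussian n"
  proof -
    have "distr M (std_gaussian n) ?g = distr M (PiM {..<n} (\<lambda>_. borel)) ?g"
      by (rule distr_cong) (auto intro!: sets_PiM_cong)
    also have "\<dots> = PiM {..<n} (\<lambda>j. distr M borel (\<lambda>\<omega>. u \<omega> $ j / \<sigma>))"
      using ind' kn indep_vars_iff_distr_eq_PiM'[where I = "{..<n}" and M' = "\<lambda>_. borel" and X = "\<lambda>j \<omega>. u \<omega> $ j / \<sigma>"]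
      by (auto simp: indep_vars_def)
    also have "\<dots> = std_gaussian n"
      using std by (intro PiM_cong) auto
    finally show ?thesis .
  qed
  obtain G where G: "gauss_isometry n G" and xi: "xi X i > 0"
    and b_ex: "\<exists>b. (\<Sum>l<k. (b l)\<^sup>2) = 1 \<and>
      (\<forall>\<theta> u. \<theta> \<in> carrier_vec k \<longrightarrow> u \<in> carrier_vec n \<longrightarrow>
        theta_LS X (X *\<^sub>v \<theta> + u) $ i = \<theta> $ i + xi X i / sqrt n * (\<Sum>l<k. b l * G (($) u) l))"
    and sh: "\<And>\<theta> u. \<theta> \<in> carrier_vec k \<Longrightarrow> u \<in> carrier_vec n \<Longrightarrow>
      sigma_hat X (X *\<^sub>v \<theta> + u) = sqrt ((\<Sum>l\<in>{k..<n}. (G (($) u) l)\<^sup>2) / (real n - real k))"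
    by (rule least_squares_rotated[OF X rank less_imp_le[OF kn]]) (use i in blast)
  from b_ex obtain b where b: "(\<Sum>l<k. (b l)\<^sup>2) = 1"
    and LS: "\<And>\<theta> u. \<theta> \<in> carrier_vec k \<Longrightarrow> u \<in> carrier_vec n \<Longrightarrow>
        theta_LS X (X *\<^sub>v \<theta> + u) $ i = \<theta> $ i + xi X i / sqrt n * (\<Sum>l<k. b l * G (($) u) l)"
    by blast
  have Gm: "G \<in> measurable (std_gaussian n) (std_gaussian n)" and law_G: "distr (std_gaussian n) (std_gaussian n) G = std_gaussian n"
    using G by (simp_all add: gauss_isometry_def)
  have Gu: "G (($) (u \<omega>)) l = \<sigma> * G (?g \<omega>) l" if "l < n" for \<omega> l
  proof -
    have "G (($) (u \<omega>)) l = G (\<lambda>l. \<sigma> * ?g \<omega> l) l"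
      using \<sigma> that by (intro gauss_isometry_local[OF G]) auto
    then show ?thesis
      using fun_cong[OF gauss_isometry_scale[OF G, of \<sigma> "?g \<omega>"], of l] by simp
  qed
  let ?ZS = "\<lambda>g. (\<Sum>l<k. b l * g l, sqrt ((\<Sum>l\<in>{k..<n}. (g l)\<^sup>2) / (real n - real k)))"
  define Z where "Z \<omega> = fst (?ZS (G (?g \<omega>)))" for \<omega>
  define S where "S \<omega> = snd (?ZS (G (?g \<omega>)))" for \<omega>
  have coord: "(\<lambda>g. g l) \<in> borel_measurable (std_gaussian n)" if "l < n" for l
    using indep_vars_std_gaussian(1)[of n] that kn
    by (simp add: prob_space.indep_vars_def2[OF prob_space_std_gaussian])
  have ZSm: "?ZS \<in> measurable (std_gaussian n) (borel \<Otimes>\<^sub>M borel)"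
    using kn by (intro measurable_Pair borel_measurable_sum borel_measurable_times borel_measurable_const
      borel_measurable_divide borel_measurable_power coord borel_measurable_sqrt) auto
  have GZm: "(\<lambda>\<omega>. G (?g \<omega>)) \<in> measurable M (std_gaussian n)"
    using measurable_compose[OF g Gm] .
  have "distr M (borel \<Otimes>\<^sub>M borel) (\<lambda>\<omega>. (Z \<omega>, S \<omega>)) =
      distr (distr (distr M (std_gaussian n) ?g) (std_gaussian n) G) (borel \<Otimes>\<^sub>M borel) ?ZS"
    unfolding distr_distr[OF Gm g] using GZm
    by (subst distr_distr[OF ZSm]) (simp_all add: comp_def Z_def S_def)
  also have "\<dots> = std_normal_distribution \<Otimes>\<^sub>M scaled_chi_distribution (n - k)"
    unfolding law_g law_G by (rule distr_combination_tail_norm_std_gaussian[OF kn b])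
  finally have law: "distr M (borel \<Otimes>\<^sub>M borel) (\<lambda>\<omega>. (Z \<omega>, S \<omega>)) = \<dots>" .
  show thesis
  proof (rule that[OF prob_space_axioms xi _ _ law])
    show "Z \<in> borel_measurable M" "S \<in> borel_measurable M"
      unfolding Z_def S_def using measurable_compose[OF GZm measurable_compose[OF ZSm measurable_fst]]
        measurable_compose[OF GZm measurable_compose[OF ZSm measurable_snd]] by simp_all
  next
    fix \<omega> assume \<omega>: "\<omega> \<in> space M"
    have "(\<Sum>l<k. b l * G (($) (u \<omega>)) l) = \<sigma> * Z \<omega>"
      using kn by (simp add: Z_def Gu sum_distrib_left mult_ac)
    then show "theta_LS X (Y \<omega>) $ i = \<theta> $ i + \<sigma> * xi X i / sqrt n * Z \<omega>"
      using u[OF \<omega>] LS[OF th, of "u \<omega>"] by simp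
    have "(\<Sum>l\<in>{k..<n}. (G (($) (u \<omega>)) l)\<^sup>2) = \<sigma>\<^sup>2 * (\<Sum>l\<in>{k..<n}. (G (?g \<omega>) l)\<^sup>2)"
      by (simp add: Gu sum_distrib_left power_mult_distrib)
    then show "sigma_hat X (Y \<omega>) = \<sigma> * S \<omega>"
      using u[OF \<omega>] sh[OF th, of "u \<omega>"] \<sigma> by (simp add: S_def real_sqrt_mult real_sqrt_divide)
  qed
qed

section \<open>The limit laws\<close>

lemma Phi_ereal [simp]: "Phi (ereal x) = cdf std_normal_distribution x"
  by (simp add: Phi_def)

lemma Phi_infty [simp]: "Phi \<infinity> = 1" "Phi (- \<infinity>) = 0"
  by (simp_all add: Phi_def)

interpretation std_normal: real_distribution std_normal_distribution
  by (rule real_dist_normal_dist)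

abbreviation \<Phi> :: "real \<Rightarrow> real" where
  "\<Phi> \<equiv> cdf std_normal_distribution"

lemma std_normal_density_le_1: "phi x \<le> 1"
proof -
  have "1 \<le> sqrt (2 * pi)"
    using pi_ge_two by (intro real_le_rsqrt) simp
  then have "1 / sqrt (2 * pi) * exp (- (x\<^sup>2 / 2)) \<le> 1 * 1"
    by (intro mult_mono) auto
  then show ?thesis
    by (simp add: std_normal_density_def)
qed

lemma std_normal_singleton: "emeasure std_normal_distribution {a} = 0"
  by (simp add: emeasure_density)

lemma emeasure_std_normal_atMost: "emeasure std_normal_distribution {..a} = ennreal (\<Phi> a)"
  by (simp add: cdf_def std_normal.emeasure_eq_measure)

lemma emeasure_std_normal_lessThan: "emeasure std_normal_distribution {..<a} = ennreal (\<Phi> a)"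
proof -
  have "emeasure std_normal_distribution {..a} = emeasure std_normal_distribution ({..<a} \<union> {a})"
    by (simp only: ivl_disj_un_singleton(2))
  also have "\<dots> = emeasure std_normal_distribution {..<a} + emeasure std_normal_distribution {a}"
    by (rule plus_emeasure[symmetric]) auto
  finally show ?thesis
    by (simp add: emeasure_std_normal_atMost std_normal_singleton)
qed

lemma emeasure_std_normal_Ioc: "a \<le> b \<Longrightarrow> emeasure std_normal_distribution {a<..b} = ennreal (\<Phi> b - \<Phi> a)"
  by (cases "a = b") (simp_all add: std_normal.cdf_diff_eq std_normal.emeasure_eq_measure)

text \<open>
  The standard normal density is bounded by 1.
\<close>

lemma Phi_lipschitz: "\<bar>\<Phi> a - \<Phi> b\<bar> \<le> \<bar>a - b\<bar>"
proof -
  have "\<Phi> b - \<Phi> a \<le> b - a" if "a \<le> b" for a b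
  proof -
    have "ennreal (\<Phi> b - \<Phi> a) = (\<integral>\<^sup>+x. ennreal (phi x) * indicator {a<..b} x \<partial>lborel)"
      using that by (simp add: emeasure_std_normal_Ioc[symmetric] emeasure_density)
    also have "\<dots> \<le> (\<integral>\<^sup>+x. indicator {a<..b} x \<partial>lborel)"
      using std_normal_density_le_1 by (intro nn_integral_mono) (auto split: split_indicator)
    also have "\<dots> = ennreal (b - a)"
      using that by simp
    finally show ?thesis
      using that by (simp add: ennreal_le_iff)
  qed
  from this[of a b] this[of b a] std_normal.cdf_nondecreasing[of a b] std_normal.cdf_nondecreasing[of b a]
  show ?thesis by linarith
qed

lemma continuous_on_Phi: "continuous_on UNIV \<Phi>"
  using Phi_lipschitz
  by (intro lipschitz_on_continuous_on[of 1]) (auto simp: lipschitz_on_def dist_real_def)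

lemma borel_measurable_Phi [measurable]: "\<Phi> \<in> borel_measurable borel"
  by (rule borel_measurable_continuous_onI[OF continuous_on_Phi])

lemma nn_integral_shifted_std_normal_density:
  assumes [measurable]: "B \<in> sets borel"
  shows "(\<integral>\<^sup>+t. ennreal (phi (t + c)) * indicator B t \<partial>lborel) = emeasure std_normal_distribution {t. t - c \<in> B}"
proof -
  have "emeasure std_normal_distribution {t. t - c \<in> B} = (\<integral>\<^sup>+t. ennreal (phi t) * indicator {t. t - c \<in> B} t \<partial>lborel)"
    by (subst emeasure_density) auto
  also have "\<dots> = (\<integral>\<^sup>+t. ennreal (phi (c + 1 * t)) * indicator {t. t - c \<in> B} (c + 1 * t) \<partial>lborel)"
    by (subst nn_integral_real_affine[where c = 1 and t = c]) auto
  also have "\<dots> = (\<integral>\<^sup>+t. ennreal (phi (t + c)) * indicator B t \<partial>lborel)"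
    by (intro nn_integral_cong) (auto simp: add.commute split: split_indicator)
  finally show ?thesis ..
qed

lemma nn_integral_shifted_std_normal_density_interval:
  "(\<integral>\<^sup>+t. ennreal (phi (t + c)) * indicator {..x} t \<partial>lborel) = ennreal (\<Phi> (x + c))"
  "(\<integral>\<^sup>+t. ennreal (phi (t + c)) * indicator {..<x} t \<partial>lborel) = ennreal (\<Phi> (x + c))"
  "a \<le> x \<Longrightarrow> (\<integral>\<^sup>+t. ennreal (phi (t + c)) * indicator {a<..x} t \<partial>lborel) = ennreal (\<Phi> (x + c) - \<Phi> (a + c))"
proof -
  have "{t. t - c \<in> {..x}} = {..x + c}" "{t. t - c \<in> {..<x}} = {..<x + c}" "{t. t - c \<in> {a<..x}} = {a + c<..x + c}"
    by auto
  then show "(\<integral>\<^sup>+t. ennreal (phi (t + c)) * indicator {..x} t \<partial>lborel) = ennreal (\<Phi> (x + c))"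
    "(\<integral>\<^sup>+t. ennreal (phi (t + c)) * indicator {..<x} t \<partial>lborel) = ennreal (\<Phi> (x + c))"
    "a \<le> x \<Longrightarrow> (\<integral>\<^sup>+t. ennreal (phi (t + c)) * indicator {a<..x} t \<partial>lborel) = ennreal (\<Phi> (x + c) - \<Phi> (a + c))"
    by (simp_all add: nn_integral_shifted_std_normal_density emeasure_std_normal_atMost
        emeasure_std_normal_lessThan emeasure_std_normal_Ioc del: atMost_iff lessThan_iff greaterThanAtMost_iff)
qed

lemma borel_measurable_of_bool_ereal [measurable]:
  "(\<lambda>t. of_bool (ereal t + \<nu> > 0) :: real) \<in> borel_measurable borel"
  "(\<lambda>t. of_bool (ereal t + \<nu> < 0) :: real) \<in> borel_measurable borel"
  by (cases \<nu>; simp; measurable)+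

lemma borel_measurable_soft_density_pair [measurable]:
  "(\<lambda>p. soft_density (fst p * e) \<nu> (snd p)) \<in> borel_measurable (borel \<Otimes>\<^sub>M borel)"
proof -
  note [measurable] = measurable_compose[OF measurable_snd borel_measurable_of_bool_ereal(1)]
    measurable_compose[OF measurable_snd borel_measurable_of_bool_ereal(2)]
  show ?thesis
    unfolding soft_density_def by measurable
qed

lemma borel_measurable_soft_density [measurable]: "soft_density e \<nu> \<in> borel_measurable borel"
  unfolding soft_density_def[abs_def] by measurable

lemma soft_density_nonneg: "soft_density e \<nu> t \<ge> 0"
  by (simp add: soft_density_def)

lemma soft_density_le_1: "soft_density e \<nu> t \<le> 1"
  using std_normal_density_le_1 by (cases "ereal t + \<nu> > 0") (auto simp: soft_density_def not_less)

lemma soft_weight_nonneg: "e \<ge> 0 \<Longrightarrow> soft_weight e \<nu> \<ge> 0"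
  by (cases \<nu>) (auto simp: soft_weight_def intro: std_normal.cdf_nondecreasing)

lemma soft_weight_le_1: "soft_weight e \<nu> \<le> 1"
proof (cases \<nu>)
  case (real v)
  then show ?thesis
    using std_normal.cdf_bounded_prob[of "- v + e"] std_normal.cdf_nonneg[of "- v - e"]
    by (simp add: soft_weight_def)
qed (simp_all add: soft_weight_def)

lemma soft_cdf_ereal: "soft_cdf e (ereal v) x = (if x + v \<ge> 0 then \<Phi> (x + e) else \<Phi> (x - e))"
  by (simp add: soft_cdf_def)

lemma soft_cdf_infty: "soft_cdf e \<infinity> x = \<Phi> (x + e)" "soft_cdf e (- \<infinity>) x = \<Phi> (x - e)"
  by (simp_all add: soft_cdf_def)

lemma soft_cdf_lower_bound: "e \<ge> 0 \<Longrightarrow> \<Phi> (x - e) \<le> soft_cdf e \<nu> x"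
  using std_normal.cdf_nondecreasing[of "x - e" "x + e"] by (cases \<nu>; simp add: soft_cdf_ereal soft_cdf_infty)

lemma soft_cdf_nonneg: "soft_cdf e \<nu> x \<ge> 0" and soft_cdf_le_1: "soft_cdf e \<nu> x \<le> 1"
  using std_normal.cdf_nonneg std_normal.cdf_bounded_prob
  by (cases \<nu>; simp add: soft_cdf_ereal soft_cdf_infty)+

lemma soft_cdf_at_top: "e \<ge> 0 \<Longrightarrow> (soft_cdf e \<nu> \<longlongrightarrow> 1) at_top"
proof (rule tendsto_sandwich)
  assume e: "e \<ge> 0"
  show "\<forall>\<^sub>F x in at_top. \<Phi> (x - e) \<le> soft_cdf e \<nu> x" "\<forall>\<^sub>F x in at_top. soft_cdf e \<nu> x \<le> 1"
    using soft_cdf_lower_bound[OF e] soft_cdf_le_1 by simp_all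
  show "((\<lambda>x. \<Phi> (x - e)) \<longlongrightarrow> 1) at_top"
    using filterlim_compose[OF std_normal.cdf_lim_at_top_prob
        filterlim_tendsto_add_at_top[OF tendsto_const[of "- e"] filterlim_ident]] by simp
qed simp

text \<open>
  If \<open>x \<ge> - v\<close>, the density contributes \<open>\<Phi> (- v - e)\<close> from the left of the atom and
  \<open>\<Phi> (x + e) - \<Phi> (- v + e)\<close> from its right, and the atom makes up exactly for the gap between these
  pieces. If \<open>x < - v\<close>, only the left piece is seen. Stated for the bare sum, the identity can
  be integrated over \<open>e\<close>.
\<close>

lemma emeasure_soft_measure_atMost:
  assumes e: "e \<ge> 0"
  shows "ennreal (soft_weight e \<nu>) * indicator (ereal ` {..x}) (- \<nu>) +
      (\<integral>\<^sup>+t\<in>{..x}. ennreal (soft_density e \<nu> t) \<partial>lborel) = ennreal (soft_cdf e \<nu> x)"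
proof (cases \<nu>)
  case PInf
  then show ?thesis
    by (auto simp: soft_density_def soft_cdf_infty nn_integral_shifted_std_normal_density_interval split: split_indicator)
next
  case MInf
  then show ?thesis
    using nn_integral_shifted_std_normal_density_interval(1)[of "- e" x]
    by (auto simp: soft_density_def soft_cdf_infty split: split_indicator)
next
  case (real v)
  show ?thesis
  proof (cases "x + v \<ge> 0")
    case True
    have "(\<integral>\<^sup>+t\<in>{..x}. ennreal (soft_density e \<nu> t) \<partial>lborel) =
        (\<integral>\<^sup>+t. ennreal (phi (t + e)) * indicator {- v<..x} t + ennreal (phi (t + (- e))) * indicator {..<- v} t \<partial>lborel)"
      using True by (intro nn_integral_cong) (auto simp: soft_density_def real split: split_indicator)
    also have "\<dots> = ennreal (\<Phi> (x + e) - \<Phi> (- v + e)) + ennreal (\<Phi> (- v + (- e)))"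
      using True nn_integral_shifted_std_normal_density_interval(2)[of "- e" "- v"]
      by (subst nn_integral_add) (auto simp: nn_integral_shifted_std_normal_density_interval(3))
    finally have d: "(\<integral>\<^sup>+t\<in>{..x}. ennreal (soft_density e \<nu> t) \<partial>lborel) = \<dots>" .
    have "- v \<in> {..x}"
      using True by simp
    then have i: "indicator (ereal ` {..x}) (- \<nu>) = (1 :: ennreal)"
      unfolding real by (simp add: indicator_def image_iff)
    have w: "soft_weight e \<nu> = \<Phi> (- v + e) - \<Phi> (- v - e)"
      by (simp add: soft_weight_def real)
    have "\<Phi> (- v - e) \<le> \<Phi> (- v + e)" "\<Phi> (- v + e) \<le> \<Phi> (x + e)"
      using e True by (auto intro: std_normal.cdf_nondecreasing)
    then show ?thesis
      unfolding d i w using True std_normal.cdf_nonneg[of "- v - e"]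
      by (simp add: real soft_cdf_ereal ennreal_plus[symmetric] del: ennreal_plus)
  next
    case False
    have "(\<integral>\<^sup>+t\<in>{..x}. ennreal (soft_density e \<nu> t) \<partial>lborel) =
        (\<integral>\<^sup>+t. ennreal (phi (t + (- e))) * indicator {..x} t \<partial>lborel)"
      using False by (intro nn_integral_cong) (auto simp: soft_density_def real split: split_indicator)
    then show ?thesis
      using False nn_integral_shifted_std_normal_density_interval(1)[of "- e" x]
      by (auto simp: real soft_cdf_ereal split: split_indicator)
  qed
qed

text \<open>
  Continuity from below along the rays up to \<open>n\<close> gives total mass 1.
\<close>

lemma real_distribution_of_cdf:
  assumes sets: "sets M = sets borel" and F: "\<And>x. emeasure M {..x} = ennreal (F x)"
    and F0: "\<And>x. F x \<ge> 0" and lim: "(F \<longlongrightarrow> 1) at_top"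
  shows "real_distribution M" and "cdf M = F"
proof -
  have space: "space M = UNIV"
    using sets_eq_imp_space_eq[OF sets] by simp
  have UN: "(\<Union>n. {..real n}) = UNIV"
    using real_arch_simple by auto
  have "(\<lambda>n. emeasure M {..real n}) \<longlonglongrightarrow> emeasure M (\<Union>n. {..real n})"
    by (rule Lim_emeasure_incseq) (auto simp: sets incseq_def)
  then have "(\<lambda>n. emeasure M {..real n}) \<longlonglongrightarrow> emeasure M UNIV"
    unfolding UN .
  moreover have "(\<lambda>n. emeasure M {..real n}) \<longlonglongrightarrow> ennreal 1"
    unfolding F by (intro tendsto_ennrealI filterlim_compose[OF lim filterlim_real_sequentially])
  ultimately have "emeasure M UNIV = ennreal 1"
    by (rule LIMSEQ_unique)
  then show "real_distribution M"
    by (intro real_distribution.intro prob_spaceI real_distribution_axioms.intro) (simp_all add: space sets)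
  show "cdf M = F"
    by (rule ext) (simp add: cdf_def measure_def F F0)
qed

lemma soft_measure_law:
  assumes e: "e \<ge> 0"
  shows "real_distribution (soft_measure e \<nu>)" and "cdf (soft_measure e \<nu>) = soft_cdf e \<nu>"
proof -
  have "emeasure (soft_measure e \<nu>) {..x} = ennreal (soft_cdf e \<nu> x)" for x
    unfolding soft_measure_def using emeasure_soft_measure_atMost[OF e]
    by (subst emeasure_atom_plus_density) auto
  then show "real_distribution (soft_measure e \<nu>)" "cdf (soft_measure e \<nu>) = soft_cdf e \<nu>"
    using real_distribution_of_cdf[of "soft_measure e \<nu>" "soft_cdf e \<nu>"] soft_cdf_nonneg soft_cdf_at_top[OF e]
    by (simp_all add: soft_measure_def)
qed

lemma cdf_normal_distribution: "cdf (density lborel (normal_density \<mu> 1)) x = \<Phi> (x - \<mu>)"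
proof -
  have "emeasure (density lborel (normal_density \<mu> 1)) {..x} =
      (\<integral>\<^sup>+t. ennreal (phi (t + (- \<mu>))) * indicator {..x} t \<partial>lborel)"
    by (subst emeasure_density) (auto simp: normal_density_def)
  also have "\<dots> = ennreal (\<Phi> (x - \<mu>))"
    using nn_integral_shifted_std_normal_density_interval(1)[of "- \<mu>" x] by simp
  finally show ?thesis
    by (simp add: cdf_def measure_def std_normal.cdf_nonneg)
qed

text \<open>
  For infinite \<open>\<nu>\<close> one of the two branches of the cdf is never taken, and for \<open>e = 0\<close> they agree.
\<close>

lemma soft_measure_normal:
  assumes e: "e \<ge> 0" and deg: "\<bar>\<nu>\<bar> = \<infinity> \<or> e = 0"
  shows "soft_measure e \<nu> = density lborel (normal_density (- real_of_ereal (sgn \<nu>) * e) 1)"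
proof (rule cdf_unique)
  show "real_distribution (soft_measure e \<nu>)"
    by (rule soft_measure_law(1)[OF e])
  show "real_distribution (density lborel (normal_density (- real_of_ereal (sgn \<nu>) * e) 1))"
    using prob_space_normal_density[of 1] by (auto simp: real_distribution_def real_distribution_axioms_def)
  show "cdf (soft_measure e \<nu>) = cdf (density lborel (normal_density (- real_of_ereal (sgn \<nu>) * e) 1))"
  proof
    fix x
    have "soft_cdf e \<nu> x = \<Phi> (x - (- real_of_ereal (sgn \<nu>) * e))"
    proof (cases \<nu>)
      case (real v)
      with deg have "e = 0" by simp
      then show ?thesis by (simp add: real soft_cdf_ereal)
    qed (simp_all add: soft_cdf_infty sgn_ereal.simps)
    then show "cdf (soft_measure e \<nu>) x = cdf (density lborel (normal_density (- real_of_ereal (sgn \<nu>) * e) 1)) x"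
      unfolding soft_measure_law(2)[OF e] by (rule trans[OF _ cdf_normal_distribution[symmetric]])
  qed
qed

section \<open>The scaled chi distribution\<close>

lemma space_scaled_chi [simp]: "space (scaled_chi_distribution m) = UNIV"
  and sets_scaled_chi [simp, measurable_cong]: "sets (scaled_chi_distribution m) = sets borel"
  by (simp_all add: scaled_chi_distribution_def)

interpretation scaled_chi: prob_space "scaled_chi_distribution m"
  by (rule prob_space_scaled_chi)

lemma AE_scaled_chi_nonneg: "AE s in scaled_chi_distribution m. s \<ge> 0"
proof -
  have "(\<lambda>z. sqrt (\<Sum>j<m. (z j)\<^sup>2) / sqrt (real m)) \<in> borel_measurable (std_gaussian m)"
    by measurable
  then show ?thesis
    unfolding scaled_chi_distribution_def
    by (subst AE_distr_iff) (auto intro!: AE_I2 divide_nonneg_nonneg sum_nonneg)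
qed

lemma set_integral_rho:
  assumes m: "m > 0" and f [measurable]: "f \<in> borel_measurable borel"
  shows "(LBINT s:{0..}. f s * rho m s) = (\<integral>s. f s \<partial>scaled_chi_distribution m)"
proof -
  have [measurable]: "rho m \<in> borel_measurable borel"
    unfolding rho_def[abs_def] by measurable
  have "(\<integral>s. f s \<partial>scaled_chi_distribution m) = (\<integral>s. rho m s *\<^sub>R f s \<partial>lborel)"
    unfolding density_rho[OF m, symmetric] by (rule integral_density) (auto simp: rho_def)
  also have "\<dots> = (LBINT s:{0..}. f s * rho m s)"
    unfolding set_lebesgue_integral_def
    by (rule Bochner_Integration.integral_cong) (auto simp: rho_def mult.commute split: split_indicator)
  finally show ?thesis ..
qed

text \<open>
  On the diagonal, \<open>E (z\<^sup>2 - 1)\<^sup>2 = 3 - 2 + 1\<close>; off the diagonal, independence makes the expectation a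
  product of means that vanish.
\<close>

lemma std_gaussian_centred_squares:
  assumes j: "j < m" and l: "l < m"
  shows "integrable (std_gaussian m) (\<lambda>z. ((z j)\<^sup>2 - 1) * ((z l)\<^sup>2 - 1))"
    and "(\<integral>z. ((z j)\<^sup>2 - 1) * ((z l)\<^sup>2 - 1) \<partial>std_gaussian m) = (if j = l then 2 else 0)"
proof -
  have m: "m > 0"
    using j by simp
  interpret prob_space "std_gaussian m"
    by (rule prob_space_std_gaussian)
  note ind = indep_vars_std_gaussian[OF m]
  have coord: "(\<lambda>z. z q) \<in> borel_measurable (std_gaussian m)" if "q < m" for q
    using ind(1) that by (simp add: indep_vars_def)
  have tr: "integrable (std_gaussian m) (\<lambda>z. f (z q)) \<longleftrightarrow> integrable std_normal_distribution f"
    "(\<integral>z. f (z q) \<partial>std_gaussian m) = (\<integral>t. f t \<partial>std_normal_distribution)"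
    if q: "q < m" and f: "f \<in> borel_measurable borel" for q and f :: "real \<Rightarrow> real"
    using integrable_distr_eq[OF coord[OF q] f] integral_distr[OF coord[OF q] f] ind(2)[OF q] by simp_all
  have mom: "integrable std_normal_distribution (\<lambda>t. t ^ p)" for p
    by (rule integrable_std_normal_distribution_moment)
  have m2: "(\<integral>t. t ^ 2 \<partial>std_normal_distribution) = 1" and m4: "(\<integral>t. t ^ 4 \<partial>std_normal_distribution) = 3"
    using std_normal_distribution_even_moments(1)[of 1] std_normal_distribution_even_moments(1)[of 2]
    by (simp_all add: fact_numeral)
  have i1: "integrable std_normal_distribution (\<lambda>t. t\<^sup>2 - 1)" and e1: "(\<integral>t. t\<^sup>2 - 1 \<partial>std_normal_distribution) = 0"
    using mom[of 2] m2 std_normal.prob_space by simp_all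
  have sq: "(t\<^sup>2 - 1) * (t\<^sup>2 - 1) = t ^ 4 - 2 * t\<^sup>2 + 1" for t :: real
    by (simp add: power2_eq_square power4_eq_xxxx algebra_simps)
  have i2: "integrable std_normal_distribution (\<lambda>t. (t\<^sup>2 - 1) * (t\<^sup>2 - 1))"
    and e2: "(\<integral>t. (t\<^sup>2 - 1) * (t\<^sup>2 - 1) \<partial>std_normal_distribution) = 2"
    unfolding sq using mom[of 4] mom[of 2] m2 m4 std_normal.prob_space by simp_all
  have "integrable (std_gaussian m) (\<lambda>z. ((z j)\<^sup>2 - 1) * ((z l)\<^sup>2 - 1)) \<and>
    (\<integral>z. ((z j)\<^sup>2 - 1) * ((z l)\<^sup>2 - 1) \<partial>std_gaussian m) = (if j = l then 2 else 0)"
  proof (cases "j = l")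
    case True
    then show ?thesis
      using tr[OF l, of "\<lambda>t. (t\<^sup>2 - 1) * (t\<^sup>2 - 1)"] i2 e2 by simp
  next
    case False
    have "indep_vars (\<lambda>_. borel) (\<lambda>q z. (z q)\<^sup>2 - 1) {j, l}"
      by (rule indep_vars_subset[OF indep_vars_compose2[OF ind(1)]]) (use j l in auto)
    moreover have "integrable (std_gaussian m) (\<lambda>z. (z q)\<^sup>2 - 1)" "(\<integral>z. (z q)\<^sup>2 - 1 \<partial>std_gaussian m) = 0"
      if "q \<in> {j, l}" for q
      using tr[of q "\<lambda>t. t\<^sup>2 - 1"] that j l i1 e1 by auto
    ultimately show ?thesis
      using indep_vars_lebesgue_integral[of "{j, l}" "\<lambda>q z. (z q)\<^sup>2 - 1"]
        indep_vars_integrable[of "{j, l}" "\<lambda>q z. (z q)\<^sup>2 - 1"] False by simp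
  qed
  then show "integrable (std_gaussian m) (\<lambda>z. ((z j)\<^sup>2 - 1) * ((z l)\<^sup>2 - 1))"
    "(\<integral>z. ((z j)\<^sup>2 - 1) * ((z l)\<^sup>2 - 1) \<partial>std_gaussian m) = (if j = l then 2 else 0)"
    by blast+
qed

lemma scaled_chi_square_variance:
  assumes m: "m > 0"
  shows "integrable (scaled_chi_distribution m) (\<lambda>s. (s\<^sup>2 - 1)\<^sup>2)"
    and "(\<integral>s. (s\<^sup>2 - 1)\<^sup>2 \<partial>scaled_chi_distribution m) = 2 / real m"
proof -
  let ?h = "\<lambda>z. sqrt (\<Sum>j<m. (z j)\<^sup>2) / sqrt (real m)"
  have h: "?h \<in> borel_measurable (std_gaussian m)"
    by measurable
  have f: "(\<lambda>s. (s\<^sup>2 - 1)\<^sup>2) \<in> borel_measurable (borel :: real measure)"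
    by measurable
  have eq: "((?h z)\<^sup>2 - 1)\<^sup>2 = (\<Sum>j<m. \<Sum>l<m. ((z j)\<^sup>2 - 1) * ((z l)\<^sup>2 - 1)) / (real m)\<^sup>2" for z :: "nat \<Rightarrow> real"
  proof -
    have "(?h z)\<^sup>2 - 1 = (\<Sum>j<m. (z j)\<^sup>2 - 1) / real m"
      using m by (simp add: power_divide sum_nonneg sum_subtractf field_simps)
    then have "((?h z)\<^sup>2 - 1)\<^sup>2 = (\<Sum>j<m. (z j)\<^sup>2 - 1)\<^sup>2 / (real m)\<^sup>2"
      by (simp only: power_divide)
    then show ?thesis
      by (simp only: power2_eq_square[of "\<Sum>j<m. (z j)\<^sup>2 - 1"] sum_product)
  qed
  have int: "integrable (std_gaussian m) (\<lambda>z. (\<Sum>j<m. \<Sum>l<m. ((z j)\<^sup>2 - 1) * ((z l)\<^sup>2 - 1)) / (real m)\<^sup>2)"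
    by (intro Bochner_Integration.integrable_divide Bochner_Integration.integrable_sum std_gaussian_centred_squares(1)) auto
  show "integrable (scaled_chi_distribution m) (\<lambda>s. (s\<^sup>2 - 1)\<^sup>2)"
    unfolding scaled_chi_distribution_def integrable_distr_eq[OF h f] eq by (rule int)
  have "(\<integral>s. (s\<^sup>2 - 1)\<^sup>2 \<partial>scaled_chi_distribution m) =
      (\<integral>z. (\<Sum>j<m. \<Sum>l<m. ((z j)\<^sup>2 - 1) * ((z l)\<^sup>2 - 1)) / (real m)\<^sup>2 \<partial>std_gaussian m)"
    unfolding scaled_chi_distribution_def integral_distr[OF h f] eq ..
  also have "\<dots> = (\<integral>z. (\<Sum>j<m. \<Sum>l<m. ((z j)\<^sup>2 - 1) * ((z l)\<^sup>2 - 1)) \<partial>std_gaussian m) / (real m)\<^sup>2"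
    by simp
  also have "(\<integral>z. (\<Sum>j<m. \<Sum>l<m. ((z j)\<^sup>2 - 1) * ((z l)\<^sup>2 - 1)) \<partial>std_gaussian m) =
      (\<Sum>j<m. \<integral>z. (\<Sum>l<m. ((z j)\<^sup>2 - 1) * ((z l)\<^sup>2 - 1)) \<partial>std_gaussian m)"
    by (intro Bochner_Integration.integral_sum Bochner_Integration.integrable_sum std_gaussian_centred_squares(1)) auto
  also have "\<dots> = (\<Sum>j<m. \<Sum>l<m. \<integral>z. ((z j)\<^sup>2 - 1) * ((z l)\<^sup>2 - 1) \<partial>std_gaussian m)"
    by (intro sum.cong refl Bochner_Integration.integral_sum std_gaussian_centred_squares(1)) auto
  also have "\<dots> = (\<Sum>j<m. \<Sum>l<m. if j = l then 2 else 0)"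
    by (intro sum.cong refl std_gaussian_centred_squares(2)) auto
  also have "\<dots> / (real m)\<^sup>2 = 2 / real m"
    using m by (simp add: sum.delta power2_eq_square)
  finally show "(\<integral>s. (s\<^sup>2 - 1)\<^sup>2 \<partial>scaled_chi_distribution m) = 2 / real m" .
qed

text \<open>
  For \<open>s \<ge> 0\<close> one has \<open>|s\<^sup>2 - 1| = |s - 1| (s + 1)\<close>, which is at least \<open>|s - 1|\<close>; the second moment
  of \<open>s\<^sup>2 - 1\<close> then bounds the first. This is the law of large numbers behind the case of growing degrees
  of freedom, with a rate.
\<close>

lemma scaled_chi_deviation:
  assumes m: "m > 0"
  shows "integrable (scaled_chi_distribution m) (\<lambda>s. \<bar>s - 1\<bar>)"
    and "(\<integral>s. \<bar>s - 1\<bar> \<partial>scaled_chi_distribution m) \<le> sqrt (2 / real m)"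
proof -
  let ?L = "scaled_chi_distribution m"
  note V = scaled_chi_square_variance[OF m]
  have le: "AE s in ?L. \<bar>s - 1\<bar> \<le> \<bar>s\<^sup>2 - 1\<bar>"
    using AE_scaled_chi_nonneg
  proof eventually_elim
    fix s :: real assume "0 \<le> s"
    then have "\<bar>s - 1\<bar> * 1 \<le> \<bar>s - 1\<bar> * (s + 1)"
      by (intro mult_left_mono) auto
    also have "\<dots> = \<bar>s\<^sup>2 - 1\<bar>"
      using \<open>0 \<le> s\<close> by (simp add: power2_eq_square square_diff_one_factored abs_mult)
    finally show "\<bar>s - 1\<bar> \<le> \<bar>s\<^sup>2 - 1\<bar>" by simp
  qed
  have I: "integrable ?L (\<lambda>s. \<bar>s\<^sup>2 - 1\<bar>)"
  proof (rule Bochner_Integration.integrable_bound)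
    show "integrable ?L (\<lambda>s. 1 + (s\<^sup>2 - 1)\<^sup>2)"
      using V(1) by simp
    have "\<bar>a\<bar> \<le> 1 + a\<^sup>2" for a :: real
      using sum_squares_bound[of "\<bar>a\<bar>" 1] by (simp add: power2_eq_square)
    then show "AE s in ?L. norm \<bar>s\<^sup>2 - 1\<bar> \<le> norm (1 + (s\<^sup>2 - 1)\<^sup>2)"
      by (auto intro: order_trans[OF _ abs_ge_self])
  qed measurable
  show I1: "integrable ?L (\<lambda>s. \<bar>s - 1\<bar>)"
    by (rule Bochner_Integration.integrable_bound[OF I]) (use le in auto)
  have "(\<integral>s. \<bar>s\<^sup>2 - 1\<bar> \<partial>?L)\<^sup>2 \<le> (\<integral>s. \<bar>s\<^sup>2 - 1\<bar>\<^sup>2 \<partial>?L)"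
    using scaled_chi.variance_positive[where X = "\<lambda>s. \<bar>s\<^sup>2 - 1\<bar>" and m = m] scaled_chi.variance_eq[OF I] V(1) by simp
  then have "(\<integral>s. \<bar>s\<^sup>2 - 1\<bar> \<partial>?L) \<le> sqrt (2 / real m)"
    using V(2) by (intro real_le_rsqrt) simp
  moreover have "(\<integral>s. \<bar>s - 1\<bar> \<partial>?L) \<le> (\<integral>s. \<bar>s\<^sup>2 - 1\<bar> \<partial>?L)"
    by (rule integral_mono_AE[OF I1 I le])
  ultimately show "(\<integral>s. \<bar>s - 1\<bar> \<partial>?L) \<le> sqrt (2 / real m)"
    by simp
qed

lemma integrable_scaled_chi:
  assumes m: "m > 0"
  shows "integrable (scaled_chi_distribution m) (\<lambda>s. s)"
proof (rule Bochner_Integration.integrable_bound)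
  show "integrable (scaled_chi_distribution m) (\<lambda>s. 1 + \<bar>s - 1\<bar>)"
    using scaled_chi_deviation(1)[OF m] by simp
qed auto

section \<open>Mixing the limit laws over the error variance estimate\<close>

lemma measure_scaled_chi_UNIV: "measure (scaled_chi_distribution m) UNIV = 1"
  using scaled_chi.prob_space[of m] by simp

lemma borel_measurable_soft_cdf_scale [measurable]: "(\<lambda>s. soft_cdf (s * e) \<nu> x) \<in> borel_measurable borel"
  by (cases \<nu>) (simp_all add: soft_cdf_ereal soft_cdf_infty)

lemma borel_measurable_soft_weight_scale [measurable]: "(\<lambda>s. soft_weight (s * e) \<nu>) \<in> borel_measurable borel"
  by (cases \<nu>) (simp_all add: soft_weight_def)

lemma borel_measurable_soft_density_scale [measurable]: "(\<lambda>s. soft_density (s * e) \<nu> t) \<in> borel_measurable borel"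
  unfolding soft_density_def by measurable

lemma soft_fixed_mixture:
  assumes m: "m > 0"
  shows soft_cdf_fixed_mixture: "soft_cdf_fixed m e \<nu> x = (\<integral>s. soft_cdf (s * e) \<nu> x \<partial>scaled_chi_distribution m)"
    and soft_weight_fixed_mixture: "soft_weight_fixed m e \<nu> = (\<integral>s. soft_weight (s * e) \<nu> \<partial>scaled_chi_distribution m)"
    and soft_density_fixed_mixture: "soft_density_fixed m e \<nu> x = (\<integral>s. soft_density (s * e) \<nu> x \<partial>scaled_chi_distribution m)"
  using set_integral_rho[OF m borel_measurable_soft_cdf_scale[of e \<nu> x]]
    set_integral_rho[OF m borel_measurable_soft_weight_scale[of e \<nu>]]
    set_integral_rho[OF m borel_measurable_soft_density_scale[of e \<nu> x]]
  by (simp_all only: soft_cdf_fixed_def soft_weight_fixed_def soft_density_fixed_def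
      soft_cdf_def soft_weight_def soft_density_def)

text \<open>
  Bounds are needed for nonnegative \<open>s\<close> only: for \<open>s < 0\<close> the weight \<open>soft_weight (s * e) \<nu>\<close> may be
  negative.
\<close>

lemma ennreal_integral_scaled_chi:
  assumes [measurable]: "f \<in> borel_measurable borel" and f: "\<And>s. s \<ge> 0 \<Longrightarrow> 0 \<le> f s \<and> f s \<le> (1 :: real)"
  shows "ennreal (\<integral>s. f s \<partial>scaled_chi_distribution m) = (\<integral>\<^sup>+s. ennreal (f s) \<partial>scaled_chi_distribution m)"
proof -
  have AE: "AE s in scaled_chi_distribution m. 0 \<le> f s \<and> f s \<le> 1"
    using AE_scaled_chi_nonneg by eventually_elim (rule f)
  have "integrable (scaled_chi_distribution m) f"
    by (rule scaled_chi.integrable_const_bound[where B = 1]) (use AE in \<open>auto elim: eventually_mono\<close>)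
  from nn_integral_eq_integral[OF this] AE show ?thesis
    by (auto elim: eventually_mono)
qed

lemma borel_measurable_soft_density_fixed [measurable]: "m > 0 \<Longrightarrow> soft_density_fixed m e \<nu> \<in> borel_measurable borel"
proof -
  assume m: "m > 0"
  have "(\<lambda>x. \<integral>s. soft_density (s * e) \<nu> x \<partial>scaled_chi_distribution m) \<in> borel_measurable borel"
  proof (rule scaled_chi.borel_measurable_lebesgue_integral)
    have "(\<lambda>p. (snd p, fst p)) \<in> measurable (borel \<Otimes>\<^sub>M scaled_chi_distribution m) (borel \<Otimes>\<^sub>M borel)"
      by measurable
    from measurable_compose[OF this borel_measurable_soft_density_pair[of e \<nu>]]
    show "(\<lambda>(x, s). soft_density (s * e) \<nu> x) \<in> borel_measurable (borel \<Otimes>\<^sub>M scaled_chi_distribution m)"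
      by (simp add: case_prod_beta)
  qed
  then show ?thesis
    by (simp add: soft_density_fixed_mixture[OF m, abs_def])
qed

text \<open>
  Fubini: weight and density are both averages over \<open>s\<close> of those with parameter \<open>s e\<close>, so the measure
  of a ray is the average of the cdfs \<open>soft_cdf (s e) \<nu>\<close>.
\<close>

lemma emeasure_soft_measure_fixed_atMost:
  assumes m: "m > 0" and e: "e \<ge> 0"
  shows "emeasure (soft_measure_fixed m e \<nu>) {..x} = ennreal (soft_cdf_fixed m e \<nu> x)"
proof -
  let ?L = "scaled_chi_distribution m"
  interpret P: pair_sigma_finite ?L "lborel :: real measure"
    by (intro pair_sigma_finite.intro scaled_chi.sigma_finite_measure sigma_finite_lborel)
  have pair [measurable]: "(\<lambda>(s, t). ennreal (soft_density (s * e) \<nu> t) * indicator {..x} t) \<in> borel_measurable (?L \<Otimes>\<^sub>M lborel)"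
  proof -
    have "(\<lambda>p. soft_density (fst p * e) \<nu> (snd p)) \<in> borel_measurable (?L \<Otimes>\<^sub>M lborel)"
      using borel_measurable_soft_density_pair[of e \<nu>]
      by (subst measurable_cong_sets[OF sets_pair_measure_cong refl, of _ borel _ borel]) auto
    then show ?thesis
      by (simp add: case_prod_beta)
  qed
  have dens: "ennreal (soft_density_fixed m e \<nu> t) = (\<integral>\<^sup>+s. ennreal (soft_density (s * e) \<nu> t) \<partial>?L)" for t
    unfolding soft_density_fixed_mixture[OF m]
    by (rule ennreal_integral_scaled_chi) (auto simp: soft_density_nonneg soft_density_le_1)
  have weight: "ennreal (soft_weight_fixed m e \<nu>) = (\<integral>\<^sup>+s. ennreal (soft_weight (s * e) \<nu>) \<partial>?L)"
    unfolding soft_weight_fixed_mixture[OF m]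
    by (rule ennreal_integral_scaled_chi) (use e in \<open>auto intro: soft_weight_nonneg soft_weight_le_1\<close>)
  have "emeasure (soft_measure_fixed m e \<nu>) {..x} =
      (\<integral>\<^sup>+s. ennreal (soft_weight (s * e) \<nu>) \<partial>?L) * indicator (ereal ` {..x}) (- \<nu>) +
      (\<integral>\<^sup>+t. \<integral>\<^sup>+s. ennreal (soft_density (s * e) \<nu> t) * indicator {..x} t \<partial>?L \<partial>lborel)"
    unfolding soft_measure_fixed_def using m
    by (subst emeasure_atom_plus_density) (auto simp: dens weight nn_integral_multc)
  also have "(\<integral>\<^sup>+t. \<integral>\<^sup>+s. ennreal (soft_density (s * e) \<nu> t) * indicator {..x} t \<partial>?L \<partial>lborel) =
      (\<integral>\<^sup>+s. (\<integral>\<^sup>+t\<in>{..x}. ennreal (soft_density (s * e) \<nu> t) \<partial>lborel) \<partial>?L)"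
    by (rule P.Fubini'[OF pair])
  also have "(\<integral>\<^sup>+s. ennreal (soft_weight (s * e) \<nu>) \<partial>?L) * indicator (ereal ` {..x}) (- \<nu>) + \<dots> =
      (\<integral>\<^sup>+s. ennreal (soft_weight (s * e) \<nu>) * indicator (ereal ` {..x}) (- \<nu>) +
        (\<integral>\<^sup>+t\<in>{..x}. ennreal (soft_density (s * e) \<nu> t) \<partial>lborel) \<partial>?L)"
  proof (subst nn_integral_add)
    show "(\<lambda>s. \<integral>\<^sup>+t\<in>{..x}. ennreal (soft_density (s * e) \<nu> t) \<partial>lborel) \<in> borel_measurable ?L"
      using lborel.borel_measurable_nn_integral[OF pair] by simp
  qed (auto simp: nn_integral_multc)
  also have "\<dots> = (\<integral>\<^sup>+s. ennreal (soft_cdf (s * e) \<nu> x) \<partial>?L)"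
    using AE_scaled_chi_nonneg[of m] e
    by (intro nn_integral_cong_AE) (auto intro!: emeasure_soft_measure_atMost elim!: eventually_mono)
  also have "\<dots> = ennreal (soft_cdf_fixed m e \<nu> x)"
    unfolding soft_cdf_fixed_mixture[OF m]
    by (rule ennreal_integral_scaled_chi[symmetric]) (auto simp: soft_cdf_nonneg soft_cdf_le_1)
  finally show ?thesis .
qed

lemma soft_measure_fixed_law:
  assumes m: "m > 0" and e: "e \<ge> 0"
  shows "real_distribution (soft_measure_fixed m e \<nu>)" and "cdf (soft_measure_fixed m e \<nu>) = soft_cdf_fixed m e \<nu>"
proof -
  let ?L = "scaled_chi_distribution m"
  have "soft_cdf_fixed m e \<nu> x \<ge> 0" for x
    unfolding soft_cdf_fixed_mixture[OF m] by (simp add: soft_cdf_nonneg)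
  moreover have "(soft_cdf_fixed m e \<nu> \<longlongrightarrow> 1) at_top"
  proof -
    have "((\<lambda>x. \<integral>s. soft_cdf (s * e) \<nu> x \<partial>?L) \<longlongrightarrow> (\<integral>s. 1 \<partial>?L)) at_top"
    proof (rule integral_dominated_convergence_at_top[where w = "\<lambda>_. 1"])
      show "AE s in ?L. ((\<lambda>x. soft_cdf (s * e) \<nu> x) \<longlongrightarrow> 1) at_top"
        using AE_scaled_chi_nonneg[of m] by eventually_elim (use e in \<open>auto intro: soft_cdf_at_top\<close>)
    qed (auto simp: soft_cdf_nonneg soft_cdf_le_1)
    then show ?thesis
      by (simp add: soft_cdf_fixed_mixture[OF m, abs_def] measure_scaled_chi_UNIV)
  qed
  ultimately show "real_distribution (soft_measure_fixed m e \<nu>)" "cdf (soft_measure_fixed m e \<nu>) = soft_cdf_fixed m e \<nu>"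
    using real_distribution_of_cdf[of "soft_measure_fixed m e \<nu>" "soft_cdf_fixed m e \<nu>"]
      emeasure_soft_measure_fixed_atMost[OF m e] by (simp_all add: soft_measure_fixed_def)
qed

lemma soft_measure_fixed_infinite_nu:
  assumes m: "m > 0" and \<nu>: "\<bar>\<nu>\<bar> = \<infinity>"
  shows "soft_measure_fixed m e \<nu> = density lborel (\<lambda>x. ennreal (soft_density_fixed m e \<nu> x))"
proof (rule measure_eqI)
  fix A assume "A \<in> sets (soft_measure_fixed m e \<nu>)"
  then have A: "A \<in> sets borel"
    by (simp add: soft_measure_fixed_def)
  have "- \<nu> \<notin> ereal ` A"
    using \<nu> by (cases \<nu>) auto
  then show "emeasure (soft_measure_fixed m e \<nu>) A = emeasure (density lborel (\<lambda>x. ennreal (soft_density_fixed m e \<nu> x))) A"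
    unfolding soft_measure_fixed_def using A m
    by (subst emeasure_atom_plus_density) (auto simp: emeasure_density)
qed (simp add: soft_measure_fixed_def)

lemma soft_measure_fixed_zero_e:
  assumes m: "m > 0"
  shows "soft_measure_fixed m 0 \<nu> = std_normal_distribution"
proof (rule cdf_unique)
  show "real_distribution (soft_measure_fixed m 0 \<nu>)"
    using soft_measure_fixed_law(1)[OF m] by simp
  have "soft_cdf 0 \<nu> x = \<Phi> x" for x
    by (cases \<nu>) (simp_all add: soft_cdf_ereal soft_cdf_infty)
  then show "cdf (soft_measure_fixed m 0 \<nu>) = \<Phi>"
    using soft_measure_fixed_law(2)[OF m, of 0]
    by (auto simp: soft_cdf_fixed_mixture[OF m] measure_scaled_chi_UNIV fun_eq_iff)
qed (rule real_dist_normal_dist)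

section \<open>The finite-sample distribution of the soft-thresholding estimator\<close>

text \<open>
  The threshold function is flat at 0 and increases with slope 1 outside \<open>[- t, t]\<close>, so its generalised
  inverse is \<open>y + t\<close> for \<open>y \<ge> 0\<close> and \<open>y - t\<close> for \<open>y < 0\<close>.
\<close>

lemma soft_threshold_le_iff:
  fixes w t y :: real
  assumes t: "t \<ge> 0"
  shows "sgn w * max (\<bar>w\<bar> - t) 0 \<le> y \<longleftrightarrow> (if y \<ge> 0 then w \<le> y + t else w \<le> y - t)"
  using t by (auto simp: sgn_real_def max_def abs_real_def split: if_splits)

lemma soft_threshold_scale:
  fixes c w t :: real
  assumes c: "c > 0"
  shows "sgn (c * w) * max (\<bar>c * w\<bar> - c * t) 0 = c * (sgn w * max (\<bar>w\<bar> - t) 0)"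
proof -
  have "max (c * \<bar>w\<bar> - c * t) (c * 0) = c * max (\<bar>w\<bar> - t) 0"
    using c by (simp add: max_mult_distrib_left right_diff_distrib)
  then show ?thesis
    using c by (simp add: sgn_mult abs_mult)
qed

lemma emeasure_soft_threshold_event:
  assumes t: "t \<ge> 0"
  shows "emeasure std_normal_distribution {z. sgn (z + v) * max (\<bar>z + v\<bar> - t) 0 \<le> x + v} =
    ennreal (soft_cdf t (ereal v) x)"
proof -
  have "{z. sgn (z + v) * max (\<bar>z + v\<bar> - t) 0 \<le> x + v} = (if x + v \<ge> 0 then {..x + t} else {..x - t})"
    unfolding soft_threshold_le_iff[OF t] by auto
  then show ?thesis
    by (simp add: soft_cdf_ereal emeasure_std_normal_atMost)
qed

text \<open>
  Conditioning on \<open>S = s\<close>, which is legitimate as the joint law is a product, leaves the probability of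
  a ray under the standard normal law.
\<close>

lemma soft_threshold_cdf:
  assumes a: "a \<ge> 0" and law: "distr M (borel \<Otimes>\<^sub>M borel) (\<lambda>\<omega>. (Z \<omega>, S \<omega>)) =
      std_normal_distribution \<Otimes>\<^sub>M scaled_chi_distribution m"
    and Z [measurable]: "Z \<in> borel_measurable M" and S [measurable]: "S \<in> borel_measurable M"
  shows "cdf (distr M borel (\<lambda>\<omega>. sgn (Z \<omega> + v) * max (\<bar>Z \<omega> + v\<bar> - S \<omega> * a) 0 - v)) x =
    (\<integral>s. soft_cdf (s * a) (ereal v) x \<partial>scaled_chi_distribution m)"
proof -
  let ?L = "scaled_chi_distribution m"
  interpret P: pair_sigma_finite std_normal_distribution ?L
    by (intro pair_sigma_finite.intro scaled_chi.sigma_finite_measure std_normal.sigma_finite_measure)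
  let ?B = "{p :: real \<times> real. sgn (fst p + v) * max (\<bar>fst p + v\<bar> - snd p * a) 0 \<le> x + v}"
  have [measurable]: "(\<lambda>x :: real. sgn x) \<in> borel_measurable borel"
    by (rule borel_measurable_sgn)
  have "{p \<in> space (borel \<Otimes>\<^sub>M borel). sgn (fst p + v) * max (\<bar>fst p + v\<bar> - snd p * a) 0 \<le> x + v} \<in>
      sets (borel \<Otimes>\<^sub>M borel)"
    by measurable
  then have B: "?B \<in> sets (borel \<Otimes>\<^sub>M borel)"
    by (simp add: space_pair_measure)
  then have B': "?B \<in> sets (std_normal_distribution \<Otimes>\<^sub>M ?L)"
    by (subst sets_pair_measure_cong[of _ borel _ borel]) auto
  have T: "(\<lambda>\<omega>. sgn (Z \<omega> + v) * max (\<bar>Z \<omega> + v\<bar> - S \<omega> * a) 0 - v) \<in> borel_measurable M"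
    by measurable
  have "emeasure (distr M borel (\<lambda>\<omega>. sgn (Z \<omega> + v) * max (\<bar>Z \<omega> + v\<bar> - S \<omega> * a) 0 - v)) {..x} =
      emeasure M ((\<lambda>\<omega>. (Z \<omega>, S \<omega>)) -` ?B \<inter> space M)"
    by (subst emeasure_distr[OF T]) (auto intro!: arg_cong[where f = "emeasure M"] simp: algebra_simps)
  also have "\<dots> = emeasure (distr M (borel \<Otimes>\<^sub>M borel) (\<lambda>\<omega>. (Z \<omega>, S \<omega>))) ?B"
    by (rule emeasure_distr[OF _ B, symmetric]) measurable
  also have "\<dots> = (\<integral>\<^sup>+s. emeasure std_normal_distribution ((\<lambda>z. (z, s)) -` ?B) \<partial>?L)"
    unfolding law by (rule P.emeasure_pair_measure_alt2[OF B'])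
  also have "\<dots> = (\<integral>\<^sup>+s. ennreal (soft_cdf (s * a) (ereal v) x) \<partial>?L)"
  proof (rule nn_integral_cong_AE)
    show "AE s in ?L. emeasure std_normal_distribution ((\<lambda>z. (z, s)) -` ?B) = ennreal (soft_cdf (s * a) (ereal v) x)"
      using AE_scaled_chi_nonneg[of m]
    proof eventually_elim
      fix s :: real assume "0 \<le> s"
      then have "0 \<le> s * a"
        using a by simp
      from emeasure_soft_threshold_event[OF this, of v x]
      show "emeasure std_normal_distribution ((\<lambda>z. (z, s)) -` ?B) = ennreal (soft_cdf (s * a) (ereal v) x)"
        by (simp add: vimage_def)
    qed
  qed
  also have "\<dots> = ennreal (\<integral>s. soft_cdf (s * a) (ereal v) x \<partial>?L)"
    by (rule ennreal_integral_scaled_chi[symmetric]) (auto simp: soft_cdf_nonneg soft_cdf_le_1)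
  finally show ?thesis
    by (simp add: cdf_def measure_def soft_cdf_nonneg)
qed

text \<open>
  The scale \<open>c = \<sigma> \<xi> / sqrt n\<close> is common to the least squares component and to the threshold, and
  soft thresholding commutes with multiplication by \<open>c\<close>. Dividing it out leaves \<open>Z\<close>, \<open>S\<close> and the two
  numbers \<open>v\<close> and \<open>sqrt n \<eta>\<close>. The cdf is monotone because \<open>T\<close> is measurable, which
  the proof obtains from its representation by \<open>Z\<close> and \<open>S\<close>.
\<close>

lemma theta_soft_cdf:
  assumes model: "gaussian_linear_model M X Y \<theta> \<sigma>" and X: "X \<in> carrier_mat n k"
    and rank: "vec_space.rank n X = k" and kn: "k < n" and i: "i < k"
    and th: "\<theta> \<in> carrier_vec k" and \<sigma>: "\<sigma> > 0" and \<eta>: "\<eta> > 0"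
  defines "T \<equiv> \<lambda>\<omega>. inverse \<sigma> * (sqrt (real n) / xi X i) * (theta_soft X \<eta> (Y \<omega>) i - \<theta> $ i)"
    and "v \<equiv> sqrt (real n) * (\<theta> $ i) / (\<sigma> * xi X i)"
  shows "cdf (distr M borel T) x =
      (\<integral>s. soft_cdf (s * (sqrt (real n) * \<eta>)) (ereal v) x \<partial>scaled_chi_distribution (n - k))"
    and "mono (cdf (distr M borel T))"
proof -
  obtain Z S where M: "prob_space M" and xi: "xi X i > 0"
    and Z: "Z \<in> borel_measurable M" and S: "S \<in> borel_measurable M"
    and law: "distr M (borel \<Otimes>\<^sub>M borel) (\<lambda>\<omega>. (Z \<omega>, S \<omega>)) =
      std_normal_distribution \<Otimes>\<^sub>M scaled_chi_distribution (n - k)"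
    and LS: "\<And>\<omega>. \<omega> \<in> space M \<Longrightarrow> theta_LS X (Y \<omega>) $ i = \<theta> $ i + \<sigma> * xi X i / sqrt n * Z \<omega>"
    and sh: "\<And>\<omega>. \<omega> \<in> space M \<Longrightarrow> sigma_hat X (Y \<omega>) = \<sigma> * S \<omega>"
    using gaussian_linear_model_joint_law[OF model X rank kn i th \<sigma>] by blast
  have n: "sqrt (real n) > 0"
    using kn by simp
  define c where "c = \<sigma> * xi X i / sqrt n"
  define a where "a = sqrt (real n) * \<eta>"
  have c: "c > 0" and a: "a \<ge> 0"
    using \<sigma> xi n \<eta> by (simp_all add: c_def a_def)
  have T: "T \<omega> = sgn (Z \<omega> + v) * max (\<bar>Z \<omega> + v\<bar> - S \<omega> * a) 0 - v" if \<omega>: "\<omega> \<in> space M" for \<omega>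
  proof -
    have cv: "\<theta> $ i = c * v"
      using \<sigma> xi n by (simp add: c_def v_def)
    have ca: "\<sigma> * S \<omega> * xi X i * \<eta> = c * (S \<omega> * a)"
      using n by (simp add: c_def a_def)
    have "theta_LS X (Y \<omega>) $ i = c * (Z \<omega> + v)"
      using LS[OF \<omega>] cv by (simp add: c_def distrib_left)
    then have "theta_soft X \<eta> (Y \<omega>) i = c * (sgn (Z \<omega> + v) * max (\<bar>Z \<omega> + v\<bar> - S \<omega> * a) 0)"
      using soft_threshold_scale[OF c, of "Z \<omega> + v" "S \<omega> * a"]
      by (simp add: theta_soft_def sh[OF \<omega>] ca)
    moreover have "inverse \<sigma> * (sqrt (real n) / xi X i) = 1 / c"
      using \<sigma> xi n by (simp add: c_def field_simps)
    ultimately show ?thesis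
      using c by (simp add: T_def cv right_diff_distrib[symmetric])
  qed
  have [measurable]: "(\<lambda>x :: real. sgn x) \<in> borel_measurable borel"
    by (rule borel_measurable_sgn)
  note Z [measurable] S [measurable]
  have "distr M borel T = distr M borel (\<lambda>\<omega>. sgn (Z \<omega> + v) * max (\<bar>Z \<omega> + v\<bar> - S \<omega> * a) 0 - v)"
    by (rule distr_cong) (auto simp: T)
  then show "cdf (distr M borel T) x =
      (\<integral>s. soft_cdf (s * (sqrt (real n) * \<eta>)) (ereal v) x \<partial>scaled_chi_distribution (n - k))"
    using soft_threshold_cdf[OF a law Z S] by (simp add: a_def)
  have "T \<in> borel_measurable M"
    by (subst measurable_cong[OF T]) measurable
  then interpret D: real_distribution "distr M borel T"
    using prob_space.real_distribution_distr[OF M] by blast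
  show "mono (cdf (distr M borel T))"
    by (intro monoI D.cdf_nondecreasing)
qed

section \<open>Convergence\<close>

text \<open>
  At a continuity point \<open>c\<close> of the limit, \<open>H n c\<close> is squeezed between the values at two neighbouring
  points, where convergence is known.
\<close>

lemma weak_conv_off_one_point:
  assumes mono: "\<forall>\<^sub>F n in sequentially. mono (H n)"
    and lim: "\<And>x. x \<noteq> c \<Longrightarrow> (\<lambda>n. H n x) \<longlonglongrightarrow> F x"
  shows "weak_conv H F"
  unfolding weak_conv_def
proof (intro allI impI)
  fix x assume cont: "isCont F x"
  show "(\<lambda>n. H n x) \<longlonglongrightarrow> F x"
  proof (cases "x = c")
    case False
    then show ?thesis by (rule lim)
  next
    case True
    show ?thesis
    proof (rule LIMSEQ_I)
      fix r :: real assume r: "r > 0"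
      obtain d where d: "d > 0" "\<And>y. \<bar>y - x\<bar> < d \<Longrightarrow> \<bar>F y - F x\<bar> < r / 2"
        using cont r unfolding continuous_at_eps_delta dist_real_def by (metis half_gt_zero)
      have near: "\<bar>F (x - d / 2) - F x\<bar> < r / 2" "\<bar>F (x + d / 2) - F x\<bar> < r / 2"
        using d by simp_all
      have "(\<lambda>n. H n (x - d / 2)) \<longlonglongrightarrow> F (x - d / 2)" "(\<lambda>n. H n (x + d / 2)) \<longlonglongrightarrow> F (x + d / 2)"
        using d True by (auto intro: lim)
      from tendstoD[OF this(1) half_gt_zero[OF r]] tendstoD[OF this(2) half_gt_zero[OF r]]
      have "\<forall>\<^sub>F n in sequentially. dist (H n (x - d / 2)) (F (x - d / 2)) < r / 2"
        "\<forall>\<^sub>F n in sequentially. dist (H n (x + d / 2)) (F (x + d / 2)) < r / 2" .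
      with mono have "\<forall>\<^sub>F n in sequentially. norm (H n x - F x) < r"
      proof eventually_elim
        case (elim n)
        then have "H n (x - d / 2) \<le> H n x" "H n x \<le> H n (x + d / 2)"
          using d by (auto intro: monoD)
        with elim near show ?case
          unfolding dist_real_def real_norm_def by linarith
      qed
      then show "\<exists>no. \<forall>n\<ge>no. norm (H n x - F x) < r"
        by (simp add: eventually_sequentially)
    qed
  qed
qed

text \<open>
  Off the atom, the branch of \<open>soft_cdf\<close> is decided by a strict inequality between \<open>\<nu>\<close> and \<open>- x\<close>, and a
  strict inequality for the limit holds eventually along the sequence, infinite limits included.
  The sign \<open>\<epsilon>\<close> lets both branches be estimated at once.
\<close>

lemma eventually_soft_cdf_sign:
  assumes v: "(\<lambda>n. ereal (v n)) \<longlonglongrightarrow> \<nu>" and x: "ereal x + \<nu> \<noteq> 0"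
  obtains \<epsilon> :: real where "\<And>e. soft_cdf e \<nu> x = \<Phi> (x + \<epsilon> * e)"
    and "\<forall>\<^sub>F n in sequentially. \<forall>e. soft_cdf e (ereal (v n)) x = \<Phi> (x + \<epsilon> * e)" and "\<bar>\<epsilon>\<bar> = 1"
proof (cases "ereal x + \<nu> > 0")
  case True
  then have "\<nu> > ereal (- x)"
    by (cases \<nu>) auto
  from order_tendstoD(1)[OF v this] have "\<forall>\<^sub>F n in sequentially. - x < v n"
    by simp
  then have "\<forall>\<^sub>F n in sequentially. \<forall>e. soft_cdf e (ereal (v n)) x = \<Phi> (x + 1 * e)"
    by eventually_elim (simp add: soft_cdf_ereal)
  moreover have "soft_cdf e \<nu> x = \<Phi> (x + 1 * e)" for e
    using True less_imp_le[OF True] by (auto simp: soft_cdf_def)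
  ultimately show ?thesis
    using that[of 1] by simp
next
  case False
  with x have neg: "ereal x + \<nu> < 0"
    by auto
  then have "\<nu> < ereal (- x)"
    by (cases \<nu>) auto
  from order_tendstoD(2)[OF v this] have "\<forall>\<^sub>F n in sequentially. v n < - x"
    by simp
  then have "\<forall>\<^sub>F n in sequentially. \<forall>e. soft_cdf e (ereal (v n)) x = \<Phi> (x + (- 1) * e)"
    by eventually_elim (simp add: soft_cdf_ereal)
  moreover have "soft_cdf e \<nu> x = \<Phi> (x + (- 1) * e)" for e
    using neg by (simp add: soft_cdf_def not_le)
  ultimately show ?thesis
    using that[of "- 1"] by simp
qed

lemma integral_Phi_lipschitz:
  assumes f [measurable]: "f \<in> borel_measurable borel" and g [measurable]: "g \<in> borel_measurable borel"
    and I: "integrable (scaled_chi_distribution m) (\<lambda>s. \<bar>f s - g s\<bar>)"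
  shows "\<bar>(\<integral>s. \<Phi> (f s) \<partial>scaled_chi_distribution m) - (\<integral>s. \<Phi> (g s) \<partial>scaled_chi_distribution m)\<bar> \<le>
    (\<integral>s. \<bar>f s - g s\<bar> \<partial>scaled_chi_distribution m)"
proof -
  let ?L = "scaled_chi_distribution m"
  have int: "integrable ?L (\<lambda>s. \<Phi> (h s))" if [measurable]: "h \<in> borel_measurable borel" for h
    by (rule scaled_chi.integrable_const_bound[where B = 1])
       (auto simp: std_normal.cdf_nonneg std_normal.cdf_bounded_prob)
  have "(\<integral>s. \<Phi> (f s) \<partial>?L) - (\<integral>s. \<Phi> (g s) \<partial>?L) = (\<integral>s. \<Phi> (f s) - \<Phi> (g s) \<partial>?L)"
    by (rule Bochner_Integration.integral_diff[symmetric]) (simp_all add: int)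
  also have "\<bar>\<dots>\<bar> \<le> (\<integral>s. \<bar>\<Phi> (f s) - \<Phi> (g s)\<bar> \<partial>?L)"
    by (rule integral_abs_bound)
  also have "\<dots> \<le> (\<integral>s. \<bar>f s - g s\<bar> \<partial>?L)"
    by (rule integral_mono[OF _ I]) (auto simp: int Phi_lipschitz)
  finally show ?thesis .
qed

lemma soft_cdf_mixture_converges_constant_df:
  assumes m: "m > 0" and a: "a \<longlonglongrightarrow> e" and v: "(\<lambda>n. ereal (v n)) \<longlonglongrightarrow> \<nu>"
    and x: "ereal x + \<nu> \<noteq> 0"
  shows "(\<lambda>n. \<integral>s. soft_cdf (s * a n) (ereal (v n)) x \<partial>scaled_chi_distribution m) \<longlonglongrightarrow> soft_cdf_fixed m e \<nu> x"
proof -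
  let ?L = "scaled_chi_distribution m"
  obtain \<epsilon> :: real where lim: "\<And>e. soft_cdf e \<nu> x = \<Phi> (x + \<epsilon> * e)"
    and ev: "\<forall>\<^sub>F n in sequentially. \<forall>e. soft_cdf e (ereal (v n)) x = \<Phi> (x + \<epsilon> * e)" and \<epsilon>: "\<bar>\<epsilon>\<bar> = 1"
    by (rule eventually_soft_cdf_sign[OF v x]) (rule that)
  have I: "integrable ?L (\<lambda>s. \<bar>s\<bar>)"
    using integrable_scaled_chi[OF m] by (rule integrable_abs)
  have bound: "\<forall>\<^sub>F n in sequentially. norm ((\<integral>s. soft_cdf (s * a n) (ereal (v n)) x \<partial>?L) - soft_cdf_fixed m e \<nu> x) \<le>
      \<bar>a n - e\<bar> * (\<integral>s. \<bar>s\<bar> \<partial>?L)"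
    using ev
  proof eventually_elim
    case (elim n)
    have d: "\<bar>(x + \<epsilon> * (s * a n)) - (x + \<epsilon> * (s * e))\<bar> = \<bar>a n - e\<bar> * \<bar>s\<bar>" for s
    proof -
      have "(x + \<epsilon> * (s * a n)) - (x + \<epsilon> * (s * e)) = \<epsilon> * (a n - e) * s"
        by (simp add: algebra_simps)
      then show ?thesis
        using \<epsilon> by (simp add: abs_mult)
    qed
    have "\<bar>(\<integral>s. \<Phi> (x + \<epsilon> * (s * a n)) \<partial>?L) - (\<integral>s. \<Phi> (x + \<epsilon> * (s * e)) \<partial>?L)\<bar> \<le>
        (\<integral>s. \<bar>(x + \<epsilon> * (s * a n)) - (x + \<epsilon> * (s * e))\<bar> \<partial>?L)"
    proof (rule integral_Phi_lipschitz)
      show "integrable ?L (\<lambda>s. \<bar>(x + \<epsilon> * (s * a n)) - (x + \<epsilon> * (s * e))\<bar>)"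
        unfolding d using I by simp
    qed measurable
    then show ?case
      unfolding d by (simp add: elim lim soft_cdf_fixed_mixture[OF m])
  qed
  have "(\<lambda>n. \<bar>a n - e\<bar> * (\<integral>s. \<bar>s\<bar> \<partial>?L)) \<longlonglongrightarrow> 0"
    using tendsto_mult_left_zero[OF tendsto_rabs_zero[OF LIM_zero[OF a]]] .
  then show ?thesis
    by (rule LIM_zero_cancel[OF Lim_null_comparison[OF bound]])
qed

lemma soft_cdf_mixture_converges_growing_df:
  assumes m: "filterlim m at_top sequentially" and a: "a \<longlonglongrightarrow> e" and v: "(\<lambda>n. ereal (v n)) \<longlonglongrightarrow> \<nu>"
    and x: "ereal x + \<nu> \<noteq> 0"
  shows "(\<lambda>n. \<integral>s. soft_cdf (s * a n) (ereal (v n)) x \<partial>scaled_chi_distribution (m n)) \<longlonglongrightarrow> soft_cdf e \<nu> x"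
proof -
  let ?L = "\<lambda>n. scaled_chi_distribution (m n)"
  obtain \<epsilon> :: real where lim: "\<And>e. soft_cdf e \<nu> x = \<Phi> (x + \<epsilon> * e)"
    and ev: "\<forall>\<^sub>F n in sequentially. \<forall>e. soft_cdf e (ereal (v n)) x = \<Phi> (x + \<epsilon> * e)" and \<epsilon>: "\<bar>\<epsilon>\<bar> = 1"
    by (rule eventually_soft_cdf_sign[OF v x]) (rule that)
  let ?b = "\<lambda>n. \<bar>a n\<bar> * sqrt (2 / real (m n)) + \<bar>a n - e\<bar>"
  have "\<forall>\<^sub>F n in sequentially. m n > 0"
    using filterlim_at_top[THEN iffD1, OF m, rule_format, of 1] by (auto elim: eventually_mono)
  with ev have bound: "\<forall>\<^sub>F n in sequentially.
      norm ((\<integral>s. soft_cdf (s * a n) (ereal (v n)) x \<partial>?L n) - soft_cdf e \<nu> x) \<le> ?b n"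
  proof eventually_elim
    case (elim n)
    note dev = scaled_chi_deviation[OF elim(2)]
    have d: "\<bar>(x + \<epsilon> * (s * a n)) - (x + \<epsilon> * a n)\<bar> = \<bar>a n\<bar> * \<bar>s - 1\<bar>" for s
    proof -
      have "(x + \<epsilon> * (s * a n)) - (x + \<epsilon> * a n) = \<epsilon> * a n * (s - 1)"
        by (simp add: algebra_simps)
      then show ?thesis
        using \<epsilon> by (simp add: abs_mult)
    qed
    have "\<bar>(\<integral>s. \<Phi> (x + \<epsilon> * (s * a n)) \<partial>?L n) - (\<integral>s. \<Phi> (x + \<epsilon> * a n) \<partial>?L n)\<bar> \<le>
        (\<integral>s. \<bar>(x + \<epsilon> * (s * a n)) - (x + \<epsilon> * a n)\<bar> \<partial>?L n)"
    proof (rule integral_Phi_lipschitz)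
      show "integrable (?L n) (\<lambda>s. \<bar>(x + \<epsilon> * (s * a n)) - (x + \<epsilon> * a n)\<bar>)"
        unfolding d using dev(1) by simp
    qed measurable
    also have "\<dots> = \<bar>a n\<bar> * (\<integral>s. \<bar>s - 1\<bar> \<partial>?L n)"
      unfolding d by simp
    also have "\<dots> \<le> \<bar>a n\<bar> * sqrt (2 / real (m n))"
      by (rule mult_left_mono[OF dev(2)]) simp
    finally have "\<bar>(\<integral>s. \<Phi> (x + \<epsilon> * (s * a n)) \<partial>?L n) - \<Phi> (x + \<epsilon> * a n)\<bar> \<le> \<bar>a n\<bar> * sqrt (2 / real (m n))"
      by (simp add: measure_scaled_chi_UNIV)
    moreover have "\<bar>\<Phi> (x + \<epsilon> * a n) - \<Phi> (x + \<epsilon> * e)\<bar> \<le> \<bar>a n - e\<bar>"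
      using Phi_lipschitz[of "x + \<epsilon> * a n" "x + \<epsilon> * e"] \<epsilon> by (simp add: right_diff_distrib[symmetric] abs_mult)
    ultimately show ?case
      unfolding real_norm_def lim elim(1)[rule_format] by linarith
  qed
  have "?b \<longlonglongrightarrow> 0"
  proof -
    have "(\<lambda>n. 2 / real (m n)) \<longlonglongrightarrow> 0"
      by (rule real_tendsto_divide_at_top[OF tendsto_const filterlim_compose[OF filterlim_real_sequentially m]])
    then have "(\<lambda>n. sqrt (2 / real (m n))) \<longlonglongrightarrow> sqrt 0"
      by (rule tendsto_real_sqrt)
    from tendsto_add[OF tendsto_mult[OF tendsto_rabs[OF a] this] tendsto_rabs_zero[OF LIM_zero[OF a]]]
    show ?thesis
      by (simp only: real_sqrt_zero mult_zero_right add_0_right)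
  qed
  then show ?thesis
    by (rule LIM_zero_cancel[OF Lim_null_comparison[OF bound]])
qed

theorem theorem34:
  fixes n0 i :: nat
    and k :: "nat \<Rightarrow> nat"
    and X :: "nat \<Rightarrow> real mat"
    and Y :: "nat \<Rightarrow> 'a \<Rightarrow> real vec"
    and P :: "nat \<Rightarrow> real vec \<Rightarrow> real \<Rightarrow> 'a measure"
    and \<eta> :: "nat \<Rightarrow> nat \<Rightarrow> real"
    and \<theta> :: "nat \<Rightarrow> real vec"
    and \<sigma> :: "nat \<Rightarrow> real"
    and e :: real
    and \<nu> :: ereal
    and H :: "nat \<Rightarrow> real \<Rightarrow> real"
  assumes k: "\<And>n. n \<ge> n0 \<Longrightarrow> 1 \<le> k n \<and> k n < n"
    and X: "\<And>n. n \<ge> n0 \<Longrightarrow> X n \<in> carrier_mat n (k n)"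
    and rank: "\<And>n. n \<ge> n0 \<Longrightarrow> vec_space.rank n (X n) = k n"
    and model: "\<And>n \<theta>' \<sigma>'. n \<ge> n0 \<Longrightarrow> \<theta>' \<in> carrier_vec (k n) \<Longrightarrow> 0 < \<sigma>' \<Longrightarrow>
      gaussian_linear_model (P n \<theta>' \<sigma>') (X n) (Y n) \<theta>' \<sigma>'"
    and tuning: "\<And>n j. n \<ge> n0 \<Longrightarrow> j < k n \<Longrightarrow> 0 < \<eta> n j"
    and standing: "\<And>j. (\<forall>\<^sub>F n in sequentially. j < k n) \<Longrightarrow>
      bdd_above {(xi (X n) j)\<^sup>2 / real n | n. n \<ge> n0 \<and> j < k n}"
    and i: "\<forall>\<^sub>F n in sequentially. i < k n"
    and xi_eta: "(\<lambda>n. xi (X n) i * \<eta> n i) \<longlonglongrightarrow> 0"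
    and e: "0 \<le> e" "(\<lambda>n. sqrt (real n) * \<eta> n i) \<longlonglongrightarrow> e"
    and theta: "\<And>n. n \<ge> n0 \<Longrightarrow> \<theta> n \<in> carrier_vec (k n)"
    and sigma: "\<And>n. n \<ge> n0 \<Longrightarrow> 0 < \<sigma> n"
    and nu: "(\<lambda>n. ereal (sqrt (real n) * (\<theta> n $ i) / (\<sigma> n * xi (X n) i))) \<longlonglongrightarrow> \<nu>"
    and H: "\<And>n. H n = cdf (distr (P n (\<theta> n) (\<sigma> n)) borel
      (\<lambda>\<omega>. inverse (\<sigma> n) * (sqrt (real n) / xi (X n) i) *
            (theta_soft (X n) (\<eta> n i) (Y n \<omega>) i - \<theta> n $ i)))"
  shows
    "(\<forall>m. (\<forall>\<^sub>F n in sequentially. n - k n = m) \<longrightarrow>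
        real_distribution (soft_measure_fixed m e \<nu>) \<and>
        cdf (soft_measure_fixed m e \<nu>) = soft_cdf_fixed m e \<nu> \<and>
        weak_conv H (soft_cdf_fixed m e \<nu>) \<and>
        (\<bar>\<nu>\<bar> = \<infinity> \<longrightarrow>
          soft_measure_fixed m e \<nu> = density lborel (\<lambda>x. ennreal (soft_density_fixed m e \<nu> x))) \<and>
        (e = 0 \<longrightarrow> soft_measure_fixed m e \<nu> = std_normal_distribution)) \<and>
     (filterlim (\<lambda>n. n - k n) at_top sequentially \<longrightarrow>
        real_distribution (soft_measure e \<nu>) \<and>
        cdf (soft_measure e \<nu>) = soft_cdf e \<nu> \<and>
        weak_conv H (soft_cdf e \<nu>) \<and>
        (\<bar>\<nu>\<bar> = \<infinity> \<or> e = 0 \<longrightarrow>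
          soft_measure e \<nu> = density lborel (normal_density (- real_of_ereal (sgn \<nu>) * e) 1)))"
proof (intro conjI allI impI)
  define a where "a n = sqrt (real n) * \<eta> n i" for n
  define v where "v n = sqrt (real n) * (\<theta> n $ i) / (\<sigma> n * xi (X n) i)" for n
  have a: "a \<longlonglongrightarrow> e" and v: "(\<lambda>n. ereal (v n)) \<longlonglongrightarrow> \<nu>"
    using e(2) nu by (simp_all add: a_def[abs_def] v_def)
  have good: "\<forall>\<^sub>F n in sequentially. n \<ge> n0 \<and> i < k n"
    using i eventually_ge_at_top[of n0] by eventually_elim simp
  have H_formula: "H n x = (\<integral>s. soft_cdf (s * a n) (ereal (v n)) x \<partial>scaled_chi_distribution (n - k n))"
    and H_mono: "mono (H n)" if n: "n \<ge> n0" "i < k n" for n x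
  proof -
    have "gaussian_linear_model (P n (\<theta> n) (\<sigma> n)) (X n) (Y n) (\<theta> n) (\<sigma> n)"
      by (rule model[OF n(1) theta[OF n(1)] sigma[OF n(1)]])
    note fs = theta_soft_cdf[OF this X[OF n(1)] rank[OF n(1)] conjunct2[OF k[OF n(1)]] n(2) theta[OF n(1)]
        sigma[OF n(1)] tuning[OF n]]
    show "H n x = (\<integral>s. soft_cdf (s * a n) (ereal (v n)) x \<partial>scaled_chi_distribution (n - k n))"
      unfolding H fs(1) a_def v_def ..
    show "mono (H n)"
      unfolding H by (rule fs(2))
  qed
  have mono: "\<forall>\<^sub>F n in sequentially. mono (H n)"
    using good by eventually_elim (simp add: H_mono)
  \<comment> \<open>For infinite \<open>\<nu>\<close> there is no atom, and \<open>real_of_ereal\<close> picks 0 as the point that monotonicity covers.\<close>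
  have off_atom: "ereal x + \<nu> \<noteq> 0" if "x \<noteq> - real_of_ereal \<nu>" for x
    using that by (cases \<nu>) auto
  {
    fix m assume m_eq: "\<forall>\<^sub>F n in sequentially. n - k n = m"
    have "\<forall>\<^sub>F n in sequentially. m > 0"
      using m_eq good by eventually_elim (use k in fastforce)
    then have m: "m > 0"
      by simp
    show "real_distribution (soft_measure_fixed m e \<nu>)" "cdf (soft_measure_fixed m e \<nu>) = soft_cdf_fixed m e \<nu>"
      using soft_measure_fixed_law[OF m e(1)] by simp_all
    show "weak_conv H (soft_cdf_fixed m e \<nu>)"
    proof (rule weak_conv_off_one_point[OF mono])
      fix x assume "x \<noteq> - real_of_ereal \<nu>"
      from soft_cdf_mixture_converges_constant_df[OF m a v off_atom[OF this]]
      show "(\<lambda>n. H n x) \<longlonglongrightarrow> soft_cdf_fixed m e \<nu> x"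
      proof (rule Lim_transform_eventually)
        show "\<forall>\<^sub>F n in sequentially.
            (\<integral>s. soft_cdf (s * a n) (ereal (v n)) x \<partial>scaled_chi_distribution m) = H n x"
          using m_eq good by eventually_elim (simp add: H_formula)
      qed
    qed
    show "soft_measure_fixed m e \<nu> = density lborel (\<lambda>x. ennreal (soft_density_fixed m e \<nu> x))" if "\<bar>\<nu>\<bar> = \<infinity>"
      by (rule soft_measure_fixed_infinite_nu[OF m that])
    show "soft_measure_fixed m e \<nu> = std_normal_distribution" if "e = 0"
      unfolding that by (rule soft_measure_fixed_zero_e[OF m])
  }
  {
    assume m: "filterlim (\<lambda>n. n - k n) at_top sequentially"
    show "weak_conv H (soft_cdf e \<nu>)"
    proof (rule weak_conv_off_one_point[OF mono])
      fix x assume "x \<noteq> - real_of_ereal \<nu>"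
      from soft_cdf_mixture_converges_growing_df[OF m a v off_atom[OF this]]
      show "(\<lambda>n. H n x) \<longlonglongrightarrow> soft_cdf e \<nu> x"
      proof (rule Lim_transform_eventually)
        show "\<forall>\<^sub>F n in sequentially.
            (\<integral>s. soft_cdf (s * a n) (ereal (v n)) x \<partial>scaled_chi_distribution (n - k n)) = H n x"
          using good by eventually_elim (simp add: H_formula)
      qed
    qed
  }
  show "real_distribution (soft_measure e \<nu>)" "cdf (soft_measure e \<nu>) = soft_cdf e \<nu>"
    using soft_measure_law[OF e(1)] by simp_all
  show "soft_measure e \<nu> = density lborel (normal_density (- real_of_ereal (sgn \<nu>) * e) 1)"
    if "\<bar>\<nu>\<bar> = \<infinity> \<or> e = 0"
    by (rule soft_measure_normal[OF e(1) that])
qed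

end
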